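(* There exist constants $c>0$ and $q_0$ such that for every power of two $q\ge q_0$ there is a family $\mathfrak{F}=\mathfrak{F}_q$ of pairwise nonisomorphic strongly regular graphs with the same parameters (i.e., all graphs in $\mathfrak{F}_q$ have the same parameters $(n,k,\lambda,\mu)$), such that $$\dim_{\mathrm{WL}}(\mathfrak{F})\le 4\quad\text{and}\quad |\mathfrak{F}|>q^{c q^2},$$ where $\dim_{\mathrm{WL}}(\mathfrak{F})$ is the maximum Weisfeiler-Leman dimension over the graphs in $\mathfrak{F}$. (That is, $|\mathfrak{F}_q|>q^{\Omega(q^2)}$.)
   Context: A graph is a pair $X=(\Omega,E)$ with $\Omega$ a finite set and $E\subseteq\Omega\times\Omega$ irreflexive and symmetric. It is strongly regular with parameters $(n,k,\lambda,\mu)$ if $|\Omega|=n$ and the number of common neighbors of two vertices $\alpha,\beta$ equals $k$, $\lambda$ or $\mu$ depending on whether $\alpha$ and $\beta$ are equal, adjacent, or (distinct and) nonadjacent. Weisfeiler-Leman dimension. Let $m\ge 2$ and let $X=(\Omega,E)$ be a graph. Define colorings $c_i=c_i^X$ ($i\ge 0$) of $\Omega^m$ as follows. For $x=(x_1,\dots,x_m)$, $c_0(x)$ is the pair consisting of $\{(a,b)\colon x_a=x_b\}$ and $\{(a,b)\colon (x_a,x_b)\in E\}$, where $a,b\in\{1,\dots,m\}$. For $i\ge 0$, $$c_{i+1}(x)=\bigl(c_i(x),\ \{\!\{(c_i(x_{1\leftarrow\alpha}),\dots,c_i(x_{m\leftarrow\alpha}))\colon \alpha\in\Omega\}\!\}\bigr),$$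 where $\{\!\{\cdot\}\!\}$ denotes a multiset and $x_{a\leftarrow\alpha}$ is obtained from $x$ by replacing the $a$-th entry by $\alpha$. Two graphs $X$ and $X'$ are $\mathrm{WL}_m$-equivalent if the sets of colors (images) of $c_i^X$ and $c_i^{X'}$ coincide for all $i\ge 0$. The Weisfeiler-Leman dimension $\dim_{\mathrm{WL}}(X)$ is the smallest $m\ge2$ such that every graph $\mathrm{WL}_m$-equivalent to $X$ is isomorphic to $X$. *)

theory Defs
  imports Complex_Main "HOL-Library.Multiset" "Graph_Theory.Graph_Theory"
begin

text \<open>
  The graphs are those of the locale \<^locale>\<open>pair_graph\<close>: a finite vertex set with an irreflexive
  symmetric relation on it.  The library defines isomorphism for digraphs with abstract arcs; the
  lemma below says what it amounts to here.
\<close>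

abbreviation graph_iso :: "'a pair_pre_digraph \<Rightarrow> 'b pair_pre_digraph \<Rightarrow> bool" where
  "graph_iso X Y \<equiv> digraph_iso (with_proj X) (with_proj Y)"

lemma graph_iso_iff:
  assumes "pair_graph X" "pair_graph Y"
  shows "graph_iso X Y \<longleftrightarrow>
    (\<exists>f. bij_betw f (pverts X) (pverts Y) \<and>
      (\<forall>a\<in>pverts X. \<forall>b\<in>pverts X. (a, b) \<in> parcs X \<longleftrightarrow> (f a, f b) \<in> parcs Y))"
  (is "_ \<longleftrightarrow> (\<exists>f. ?P f)")
proof
  interpret X: pair_graph X by fact
  assume "graph_iso X Y"
  then obtain h where h: "pre_digraph.digraph_isomorphism (with_proj X) h"
    and Y: "with_proj Y = app_iso h (with_proj X)"
    unfolding digraph_iso_def by auto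
  define f where "f = iso_verts h"
  have inj: "inj_on f (pverts X)"
    and hd: "\<And>e. e \<in> parcs X \<Longrightarrow> f (fst e) = iso_tail h (iso_arcs h e)"
      "\<And>e. e \<in> parcs X \<Longrightarrow> f (snd e) = iso_head h (iso_arcs h e)"
    using h by (auto simp: pre_digraph.digraph_isomorphism_def f_def)
  have V: "pverts Y = f ` pverts X" and E: "parcs Y = iso_arcs h ` parcs X"
    and T: "iso_tail h = fst" "iso_head h = snd"
    using Y by (auto simp: with_proj_def app_iso_def f_def)
  have "iso_arcs h e = (f (fst e), f (snd e))" if "e \<in> parcs X" for e
    using hd[OF that] T by (metis prod.collapse)
  then have E': "parcs Y = (\<lambda>e. (f (fst e), f (snd e))) ` parcs X"
    using E by simp
  have "?P f"
    using inj X.in_arcsD1 X.in_arcsD2 unfolding V E' bij_betw_def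
    by (auto simp: image_iff Bex_def inj_on_eq_iff)
  then show "\<exists>f. ?P f" by blast
next
  interpret X: pair_graph X by fact
  interpret Y: pair_graph Y by fact
  assume "\<exists>f. ?P f"
  then obtain f where f: "?P f" ..
  define h where "h = \<lparr>iso_verts = f, iso_arcs = map_prod f f, iso_head = snd, iso_tail = fst\<rparr>"
  have inj: "inj_on f (pverts X)" and V: "pverts Y = f ` pverts X"
    using f by (auto simp: bij_betw_def)
  have "inj_on (map_prod f f) (parcs X)"
    by (rule inj_on_subset[OF map_prod_inj_on[OF inj inj]]) (auto dest: X.in_arcsD1 X.in_arcsD2)
  then have "pre_digraph.digraph_isomorphism (with_proj X) h"
    using inj X.wf_digraph by (auto simp: pre_digraph.digraph_isomorphism_def h_def)
  moreover have "parcs Y = map_prod f f ` parcs X"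
  proof
    show "map_prod f f ` parcs X \<subseteq> parcs Y"
    proof
      fix e assume "e \<in> map_prod f f ` parcs X"
      then obtain a b where ab: "(a, b) \<in> parcs X" "e = (f a, f b)" by auto
      then show "e \<in> parcs Y"
        using f X.in_arcsD1[OF ab(1)] X.in_arcsD2[OF ab(1)] by blast
    qed
    show "parcs Y \<subseteq> map_prod f f ` parcs X"
    proof
      fix e assume e: "e \<in> parcs Y"
      obtain u v where uv: "e = (u, v)" by force
      with e have "u \<in> f ` pverts X" "v \<in> f ` pverts X"
        using Y.in_arcsD1 Y.in_arcsD2 V by auto
      then obtain a b where "a \<in> pverts X" "b \<in> pverts X" "u = f a" "v = f b" by auto
      then show "e \<in> map_prod f f ` parcs X"
        using f e uv by (auto intro!: image_eqI[of _ _ "(a, b)"])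
    qed
  qed
  then have "with_proj Y = app_iso h (with_proj X)"
    using V by (simp add: with_proj_def app_iso_def h_def)
  ultimately show "graph_iso X Y"
    unfolding digraph_iso_def by blast
qed

definition common_neighbors :: "'a pair_pre_digraph \<Rightarrow> 'a \<Rightarrow> 'a \<Rightarrow> 'a set" where
  "common_neighbors X a b = {v \<in> pverts X. (a, v) \<in> parcs X \<and> (b, v) \<in> parcs X}"

text \<open>
  Complete and edgeless graphs are not excluded.
\<close>

definition strongly_regular :: "'a pair_pre_digraph \<Rightarrow> nat \<Rightarrow> nat \<Rightarrow> nat \<Rightarrow> nat \<Rightarrow> bool" where
  "strongly_regular X n k l \<mu> \<longleftrightarrow>
    pair_graph X \<and> card (pverts X) = n \<and>
    (\<forall>a\<in>pverts X. \<forall>b\<in>pverts X.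
      card (common_neighbors X a b) = (if a = b then k else if (a, b) \<in> parcs X then l else \<mu>))"

text \<open>
  Colors form a datatype of their own, so that colors of tuples of different graphs, even over
  different vertex types, can be compared.  Tuples are lists, with positions counted from \<open>0\<close>.
\<close>

datatype wl_color =
    Atomic "(nat \<times> nat) set" "(nat \<times> nat) set"
  | Refined wl_color "wl_color list multiset"

primrec wl_coloring :: "'a pair_pre_digraph \<Rightarrow> nat \<Rightarrow> 'a list \<Rightarrow> wl_color" where
  "wl_coloring X 0 x =
    Atomic {(a, b). a < length x \<and> b < length x \<and> x ! a = x ! b}
           {(a, b). a < length x \<and> b < length x \<and> (x ! a, x ! b) \<in> parcs X}"
| "wl_coloring X (Suc i) x =
    Refined (wl_coloring X i x)
      (image_mset (\<lambda>\<alpha>. map (\<lambda>a. wl_coloring X i (x[a := \<alpha>])) [0..<length x])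
        (mset_set (pverts X)))"

definition tuples :: "nat \<Rightarrow> 'a pair_pre_digraph \<Rightarrow> 'a list set" where
  "tuples m X = {x. length x = m \<and> set x \<subseteq> pverts X}"

definition wl_equivalent :: "nat \<Rightarrow> 'a pair_pre_digraph \<Rightarrow> 'b pair_pre_digraph \<Rightarrow> bool" where
  "wl_equivalent m X Y \<longleftrightarrow>
    (\<forall>i. wl_coloring X i ` tuples m X = wl_coloring Y i ` tuples m Y)"

text \<open>
  A definition cannot quantify over all vertex types, so the competing graphs have natural numbers
  as vertices.  Every finite graph is isomorphic to such a graph, and the lemmas below show that
  nothing is lost; the last one shows that the minimum exists.
\<close>

definition wl_identified :: "nat \<Rightarrow> 'a pair_pre_digraph \<Rightarrow> bool" where
  "wl_identified m X \<longleftrightarrow>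
    (\<forall>Y :: nat pair_pre_digraph. pair_graph Y \<and> wl_equivalent m X Y \<longrightarrow> graph_iso X Y)"

definition wl_dim :: "'a pair_pre_digraph \<Rightarrow> nat" where
  "wl_dim X = (LEAST m. 2 \<le> m \<and> wl_identified m X)"

definition wl_dim_family :: "'a pair_pre_digraph set \<Rightarrow> nat" where
  "wl_dim_family F = Max (wl_dim ` F)"

lemma wl_coloring_map:
  assumes "bij_betw f (pverts X) (pverts Y)"
    and "\<And>a b. a \<in> pverts X \<Longrightarrow> b \<in> pverts X \<Longrightarrow> (a, b) \<in> parcs X \<longleftrightarrow> (f a, f b) \<in> parcs Y"
    and "set x \<subseteq> pverts X"
  shows "wl_coloring Y i (map f x) = wl_coloring X i x"
  using assms(3)
proof (induction i arbitrary: x)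
  case 0
  have inj: "inj_on f (pverts X)" using assms(1) by (simp add: bij_betw_def)
  have "x ! a \<in> pverts X" if "a < length x" for a using 0 that by auto
  then show ?case
    using inj assms(2) by (auto simp: inj_on_eq_iff)
next
  case (Suc i)
  have Y: "mset_set (pverts Y) = image_mset f (mset_set (pverts X))"
    using assms(1) by (metis bij_betw_def image_mset_mset_set)
  have *: "map (\<lambda>a. wl_coloring Y i ((map f x)[a := f \<alpha>])) [0..<length x] =
      map (\<lambda>a. wl_coloring X i (x[a := \<alpha>])) [0..<length x]" if "\<alpha> \<in> pverts X" for \<alpha>
  proof (rule map_cong[OF refl])
    fix a
    have "set (x[a := \<alpha>]) \<subseteq> pverts X"
      using Suc.prems that set_update_subset_insert[of x a \<alpha>] by auto
    then show "wl_coloring Y i ((map f x)[a := f \<alpha>]) = wl_coloring X i (x[a := \<alpha>])"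
      using Suc.IH by (simp flip: map_update)
  qed
  have "image_mset (\<lambda>\<alpha>. map (\<lambda>a. wl_coloring Y i ((map f x)[a := f \<alpha>])) [0..<length x])
        (mset_set (pverts X)) =
      image_mset (\<lambda>\<alpha>. map (\<lambda>a. wl_coloring X i (x[a := \<alpha>])) [0..<length x])
        (mset_set (pverts X))"
    by (rule image_mset_cong, rule *) (metis elem_mset_set empty_iff infinite_set_mset_mset_set)
  then show ?case
    using Suc by (simp add: Y multiset.map_comp comp_def)
qed

lemma wl_equivalent_iso:
  assumes "pair_graph X" "pair_graph Y" "graph_iso X Y"
  shows "wl_equivalent m X Y"
proof -
  obtain f where f: "bij_betw f (pverts X) (pverts Y)"
    "\<And>a b. a \<in> pverts X \<Longrightarrow> b \<in> pverts X \<Longrightarrow> (a, b) \<in> parcs X \<longleftrightarrow> (f a, f b) \<in> parcs Y"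
    using assms graph_iso_iff by blast
  have "lists (pverts Y) = map f ` lists (pverts X)"
    using f(1) lists_image[of f "pverts X"] by (simp add: bij_betw_def)
  then have "tuples m Y = map f ` tuples m X"
    unfolding tuples_def by (auto simp: lists_eq_set set_eq_iff image_iff)
  moreover have "wl_coloring Y i (map f x) = wl_coloring X i x" if "x \<in> tuples m X" for i x
    using wl_coloring_map[OF f] that by (simp add: tuples_def)
  ultimately show ?thesis
    by (auto simp: wl_equivalent_def image_image cong: image_cong_simp)
qed

lemma graph_iso_nat:
  assumes "pair_graph X"
  obtains Y :: "nat pair_pre_digraph" where "pair_graph Y" "graph_iso X Y"
proof -
  interpret X: pair_graph X by fact
  obtain f :: "'a \<Rightarrow> nat" where f: "inj_on f (pverts X)"
    using finite_imp_inj_to_nat_seg X.pair_finite_verts by metis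
  define Y where "Y = \<lparr>pverts = f ` pverts X, parcs = map_prod f f ` parcs X\<rparr>"
  have V: "fst e \<in> pverts X \<and> snd e \<in> pverts X" if "e \<in> parcs X" for e
    using that by (cases e) (auto dest: X.in_arcsD1 X.in_arcsD2)
  have "symmetric X" by (rule X.pair_sym_arcs)
  then have sym: "symmetric Y"
    unfolding symmetric_def with_proj_simps Y_def
    by (auto simp: sym_def intro: rev_image_eqI)
  have loop: "fst e \<noteq> snd e" if e: "e \<in> parcs Y" for e
  proof -
    obtain d where d: "d \<in> parcs X" "e = map_prod f f d" using e by (auto simp: Y_def)
    then show ?thesis
      using V[OF d(1)] X.pair_no_loops[OF d(1)] f by (simp add: inj_on_eq_iff)
  qed
  have mem: "fst e \<in> pverts Y" "snd e \<in> pverts Y" if "e \<in> parcs Y" for e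
    using that by (auto simp: Y_def dest: X.in_arcsD1 X.in_arcsD2)
  have Y: "pair_graph Y"
    using sym mem loop X.pair_finite_verts X.pair_finite_arcs
    by unfold_locales (simp_all add: Y_def)
  have "graph_iso X Y"
    unfolding graph_iso_iff[OF assms Y]
  proof (intro exI[of _ f] conjI ballI)
    show "bij_betw f (pverts X) (pverts Y)" using f by (simp add: Y_def bij_betw_def)
    fix a b assume ab: "a \<in> pverts X" "b \<in> pverts X"
    show "(a, b) \<in> parcs X \<longleftrightarrow> (f a, f b) \<in> parcs Y"
    proof
      assume "(f a, f b) \<in> parcs Y"
      then obtain c d where cd: "(c, d) \<in> parcs X" "f c = f a" "f d = f b"
        by (auto simp: Y_def)
      then show "(a, b) \<in> parcs X"
        using f ab X.in_arcsD1[OF cd(1)] X.in_arcsD2[OF cd(1)] by (simp add: inj_on_eq_iff)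
    qed (auto simp: Y_def)
  qed
  with Y show ?thesis by (rule that)
qed

lemma wl_identifiedD:
  fixes X :: "'a pair_pre_digraph"
  assumes "pair_graph X" "wl_identified m X"
    and "pair_graph (Z :: 'b pair_pre_digraph)" "wl_equivalent m X Z"
  shows "graph_iso X Z"
proof -
  obtain Y :: "nat pair_pre_digraph" where Y: "pair_graph Y" "graph_iso Z Y"
    using graph_iso_nat assms(3) .
  then have "wl_equivalent m Z Y" using wl_equivalent_iso assms(3) by blast
  then have "wl_equivalent m X Y" using assms(4) by (simp add: wl_equivalent_def)
  then have "graph_iso X Y" using assms(2) Y(1) by (simp add: wl_identified_def)
  then obtain f g where fg: "bij_betw f (pverts X) (pverts Y)"
    "\<And>a b. a \<in> pverts X \<Longrightarrow> b \<in> pverts X \<Longrightarrow> (a, b) \<in> parcs X \<longleftrightarrow> (f a, f b) \<in> parcs Y"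
    "bij_betw g (pverts Z) (pverts Y)"
    "\<And>a b. a \<in> pverts Z \<Longrightarrow> b \<in> pverts Z \<Longrightarrow> (a, b) \<in> parcs Z \<longleftrightarrow> (g a, g b) \<in> parcs Y"
    using graph_iso_iff[OF assms(1) Y(1)] graph_iso_iff[OF assms(3) Y(1)] Y(2) by blast
  define h where "h = inv_into (pverts Z) g"
  have "bij_betw h (pverts Y) (pverts Z)"
    unfolding h_def using fg(3) by (rule bij_betw_inv_into)
  moreover have gh: "g (h y) = y" "h y \<in> pverts Z" if "y \<in> pverts Y" for y
    using that fg(3) calculation bij_betwE by (force simp: h_def bij_betw_inv_into_right)+
  moreover have fY: "f a \<in> pverts Y" if "a \<in> pverts X" for a
    using that fg(1) bij_betwE by blast
  ultimately show ?thesis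
    unfolding graph_iso_iff[OF assms(1,3)]
    using fg by (intro exI[of _ "h \<circ> f"]) (auto intro: bij_betw_trans)
qed

lemma tuple_with_set:
  assumes "S \<subseteq> pverts Z" "finite S" "S \<noteq> {}" "card S \<le> m"
  shows "\<exists>z\<in>tuples m Z. set z = S"
proof -
  obtain xs where "set xs = S" "length xs = card S"
    using finite_distinct_list[OF assms(2)] distinct_card by metis
  then show ?thesis
    using assms by (intro bexI[of _ "xs @ replicate (m - card S) (hd xs)"])
      (auto simp: tuples_def)
qed

lemma wl_identified_exists:
  fixes X :: "'a pair_pre_digraph"
  assumes "pair_graph X"
  shows "\<exists>m\<ge>2. wl_identified m X"
proof -
  interpret X: pair_graph X by fact
  define n where "n = card (pverts X)"
  define m where "m = n + 2"
  have "graph_iso X Y" if Y: "pair_graph Y" and eq: "wl_equivalent m X Y"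
    for Y :: "nat pair_pre_digraph"
  proof -
    interpret Y: pair_graph Y by fact
    have im: "wl_coloring X 0 ` tuples m X = wl_coloring Y 0 ` tuples m Y"
      using eq unfolding wl_equivalent_def by blast
    have bij: "\<exists>f. bij_betw f (set x) (set y) \<and>
        (\<forall>u\<in>set x. \<forall>v\<in>set x. (u, v) \<in> parcs X \<longleftrightarrow> (f u, f v) \<in> parcs Y)"
      if xy: "x \<in> tuples m X" "y \<in> tuples m Y" "wl_coloring X 0 x = wl_coloring Y 0 y" for x y
    proof -
      have len: "length x = m" "length y = m" using xy by (auto simp: tuples_def)
      have eqs: "x ! a = x ! b \<longleftrightarrow> y ! a = y ! b"
        "(x ! a, x ! b) \<in> parcs X \<longleftrightarrow> (y ! a, y ! b) \<in> parcs Y" if "a < m" "b < m" for a b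
        using xy(3) that len by (auto simp: set_eq_iff)
      define f where "f v = y ! (SOME a. a < m \<and> x ! a = v)" for v
      have f: "f (x ! a) = y ! a" if "a < m" for a
      proof -
        have "(SOME b. b < m \<and> x ! b = x ! a) < m \<and> x ! (SOME b. b < m \<and> x ! b = x ! a) = x ! a"
          using that by (intro someI[of "\<lambda>b. b < m \<and> x ! b = x ! a"]) simp
        then show ?thesis using eqs(1) that unfolding f_def by blast
      qed
      have "f ` set x = set y"
        using f len by (force simp: in_set_conv_nth image_iff)
      moreover have "inj_on f (set x)"
        using f len eqs(1) by (auto simp: inj_on_def in_set_conv_nth)
      ultimately show ?thesis
        using f len eqs(2) by (intro exI[of _ f]) (auto simp: bij_betw_def in_set_conv_nth)
    qed
    have le: "card (pverts Y) \<le> n"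
    proof (rule ccontr)
      assume "\<not> card (pverts Y) \<le> n"
      then obtain T where T: "T \<subseteq> pverts Y" "card T = Suc n"
        by (meson not_less_eq_eq obtain_subset_with_card_n)
      then have "finite T" "T \<noteq> {}" by (auto intro: card_ge_0_finite)
      then obtain y where y: "y \<in> tuples m Y" "set y = T"
        using tuple_with_set[of T Y m] T by (auto simp: m_def)
      then obtain x where x: "x \<in> tuples m X" "wl_coloring X 0 x = wl_coloring Y 0 y"
        using im by (metis (no_types, lifting) imageE imageI)
      then have "card (set x) = Suc n"
        using bij[OF x(1) y(1) x(2)] y(2) T(2) bij_betw_same_card by metis
      moreover have "card (set x) \<le> n"
        using x(1) X.pair_finite_verts by (auto simp: tuples_def n_def intro: card_mono)
      ultimately show False by simp
    qed
    show ?thesis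
    proof (cases "pverts X = {}")
      case True
      then have "pverts Y = {}" using le Y.pair_finite_verts by (simp add: n_def)
      with True show ?thesis
        by (auto simp: graph_iso_iff[OF assms Y] intro: bij_betw_imageI)
    next
      case False
      then obtain x where x: "x \<in> tuples m X" "set x = pverts X"
        using tuple_with_set[of "pverts X" X m] X.pair_finite_verts by (auto simp: m_def n_def)
      then obtain y where y: "y \<in> tuples m Y" "wl_coloring X 0 x = wl_coloring Y 0 y"
        using im by (metis (no_types, lifting) imageE imageI)
      obtain f where f: "bij_betw f (pverts X) (set y)"
        "\<forall>u\<in>pverts X. \<forall>v\<in>pverts X. (u, v) \<in> parcs X \<longleftrightarrow> (f u, f v) \<in> parcs Y"
        using bij[OF x(1) y] x(2) by auto
      have "set y = pverts Y"
        using y(1) le Y.pair_finite_verts bij_betw_same_card[OF f(1)]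
        by (intro card_seteq) (auto simp: tuples_def n_def)
      then show ?thesis
        unfolding graph_iso_iff[OF assms Y] using f by auto
    qed
  qed
  then have "wl_identified m X" by (simp add: wl_identified_def)
  then show ?thesis by (intro exI[of _ m]) (simp add: m_def)
qed

end

theory Submission
  imports Defs
begin

text \<open>
  The number of vertices is not tied to \<open>q\<close>, so Latin square graphs of order \<open>2q\<^sup>2\<close>
  suffice.  In a Latin square whose first column is in natural order and whose first two rows are
  \<open>0, 1, 2, \<dots>\<close> and \<open>1, 2, \<dots>, 0\<close>, individualize the cells \<open>(0, 0)\<close>, \<open>(0, 1)\<close>, \<open>(1, 0)\<close>.
  Color refinement recognizes the line through two individualized collinear cells, and then the
  third line through any cell in which two recognized lines meet; walking along the first two rows
  and the first column it recognizes every line, hence every cell.  Three fixed points and color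
  refinement fit into 4-dimensional Weisfeiler-Leman, so these graphs have dimension at most 4.

  The same labeling shows that an isomorphism between two such graphs fixing the three cells is the
  identity, so an isomorphism class contains at most \<open>|V|\<^sup>3\<close> of the squares.  Switching
  intercalates in the Cayley table of \<open>\<int>/2m\<close> gives \<open>2\<close> to the power \<open>(m - 2)(m - 1)\<close> squares,
  and \<open>m = q\<^sup>2\<close> is large enough.
\<close>

section \<open>Indistinguishable tuples\<close>

text \<open>Turns equality of the multisets in a refinement round into a matching of vertices: pair
  one element with a partner of equal value, remove both, and continue by induction.\<close>

lemma image_mset_eq_imp_bij_betw:
  assumes "finite A" "finite B" "image_mset f (mset_set A) = image_mset g (mset_set B)"
  shows "\<exists>\<beta>. bij_betw \<beta> A B \<and> (\<forall>x\<in>A. g (\<beta> x) = f x)"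
  using assms
proof (induction A arbitrary: B rule: finite_induct)
  case empty
  then have "B = {}" by (auto simp: mset_set_empty_iff)
  then show ?case by (auto simp: bij_betw_def)
next
  case (insert a A)
  have "f a \<in># image_mset g (mset_set B)"
    using insert by (metis finite_insert image_eqI insertI1 set_image_mset finite_set_mset_mset_set)
  then obtain b where b: "b \<in> B" "g b = f a"
    using insert.prems by auto
  then have "mset_set B = add_mset b (mset_set (B - {b}))"
    using insert.prems by (metis mset_set.remove)
  then have "image_mset f (mset_set A) = image_mset g (mset_set (B - {b}))"
    using insert b by simp
  then obtain \<beta> where \<beta>: "bij_betw \<beta> A (B - {b})" "\<forall>x\<in>A. g (\<beta> x) = f x"
    using insert.IH[of "B - {b}"] insert.prems by blast
  have "bij_betw (\<beta>(a := b)) A (B - {b})"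
    using \<beta>(1) insert.hyps by (metis bij_betw_cong fun_upd_other)
  then have "bij_betw (\<beta>(a := b)) (insert a A) (insert b (B - {b}))"
    using insert.hyps notIn_Un_bij_betw[of a A "\<beta>(a := b)" "B - {b}"] by simp
  then have "bij_betw (\<beta>(a := b)) (insert a A) B"
    using b(1) by (simp add: insert_absorb)
  moreover have "\<forall>x\<in>insert a A. g ((\<beta>(a := b)) x) = f x"
    using \<beta>(2) b(2) insert.hyps by auto
  ultimately show ?case by blast
qed

text \<open>Compactness: if every element of \<open>B\<close> failed at some level, none would
  survive at the largest of these levels.\<close>

lemma finite_decreasing_choice:
  fixes P :: "nat \<Rightarrow> 'b \<Rightarrow> bool"
  assumes "finite B" and ex: "\<And>i. \<exists>b\<in>B. P i b"
    and dec: "\<And>i j b. P i b \<Longrightarrow> j \<le> i \<Longrightarrow> P j b"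
  shows "\<exists>b\<in>B. \<forall>i. P i b"
proof (rule ccontr)
  assume "\<not> ?thesis"
  then obtain k where k: "\<And>b. b \<in> B \<Longrightarrow> \<not> P (k b) b" by metis
  obtain b where b: "b \<in> B" "P (Max (k ` B)) b" using ex by blast
  then have "k b \<le> Max (k ` B)" using assms(1) by simp
  then show False using dec[OF b(2)] k[OF b(1)] by blast
qed

text \<open>A refined color has the previous color as its first component.\<close>

lemma wl_coloring_eq_mono:
  assumes "wl_coloring X i x = wl_coloring Y i y" "j \<le> i"
  shows "wl_coloring X j x = wl_coloring Y j y"
  using assms by (induction i) (auto simp: le_Suc_eq simp del: wl_coloring.simps(1))

text \<open>Agreement in all rounds stands for equality of stable colors, so that no round of
  stabilization has to be named.\<close>

definition wl_indist :: "'a pair_pre_digraph \<Rightarrow> 'a list \<Rightarrow> 'b pair_pre_digraph \<Rightarrow> 'b list \<Rightarrow> bool" where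
  "wl_indist X x Y y \<longleftrightarrow> (\<forall>i. wl_coloring X i x = wl_coloring Y i y)"

lemma wl_indist_atomic:
  assumes "wl_indist X x Y y" "a < length x" "b < length x" "length y = length x"
  shows "x ! a = x ! b \<longleftrightarrow> y ! a = y ! b"
    "(x ! a, x ! b) \<in> parcs X \<longleftrightarrow> (y ! a, y ! b) \<in> parcs Y"
proof -
  have "wl_coloring X 0 x = wl_coloring Y 0 y" using assms(1) unfolding wl_indist_def by blast
  then show "x ! a = x ! b \<longleftrightarrow> y ! a = y ! b"
    "(x ! a, x ! b) \<in> parcs X \<longleftrightarrow> (y ! a, y ! b) \<in> parcs Y"
    using assms(2-) by (auto simp: set_eq_iff)
qed

text \<open>Equal color sets give a tuple of the right color for each round separately; finiteness
  of \<open>tuples m Y\<close> lets one tuple serve all rounds.\<close>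

lemma wl_equivalent_imp_indist:
  assumes "wl_equivalent m X Y" "x \<in> tuples m X" "finite (pverts Y)"
  shows "\<exists>y\<in>tuples m Y. wl_indist X x Y y"
  unfolding wl_indist_def
proof (rule finite_decreasing_choice)
  have "tuples m Y = {y. set y \<subseteq> pverts Y \<and> length y = m}" by (auto simp: tuples_def)
  then show "finite (tuples m Y)" using finite_lists_length_eq[OF assms(3)] by simp
  fix i
  have "wl_coloring X i x \<in> wl_coloring Y i ` tuples m Y"
    using assms(1,2) by (auto simp: wl_equivalent_def)
  then show "\<exists>y\<in>tuples m Y. wl_coloring X i x = wl_coloring Y i y" by blast
qed (rule wl_coloring_eq_mono)

text \<open>At each level there is a bijection; as there are finitely many, one works at all levels.\<close>

lemma wl_indist_bij:
  assumes "wl_indist X x Y y" "length y = length x" "finite (pverts X)" "finite (pverts Y)"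
  shows "\<exists>\<beta>. bij_betw \<beta> (pverts X) (pverts Y) \<and>
    (\<forall>v\<in>pverts X. \<forall>a<length x. wl_indist X (x[a := v]) Y (y[a := \<beta> v]))"
proof -
  let ?P = "\<lambda>i \<beta>. bij_betw \<beta> (pverts X) (pverts Y) \<and>
    (\<forall>v\<in>pverts X. \<forall>a<length x. wl_coloring X i (x[a := v]) = wl_coloring Y i (y[a := \<beta> v]))"
  have "\<exists>\<beta>\<in>pverts X \<rightarrow>\<^sub>E pverts Y. \<forall>i. ?P i \<beta>"
  proof (rule finite_decreasing_choice)
    show "finite (pverts X \<rightarrow>\<^sub>E pverts Y)" using assms by (intro finite_PiE) auto
  next
    fix i
    have "wl_coloring X (Suc i) x = wl_coloring Y (Suc i) y"
      using assms(1) unfolding wl_indist_def by blast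
    then have "image_mset (\<lambda>v. map (\<lambda>a. wl_coloring X i (x[a := v])) [0..<length x]) (mset_set (pverts X)) =
      image_mset (\<lambda>v. map (\<lambda>a. wl_coloring Y i (y[a := v])) [0..<length x]) (mset_set (pverts Y))"
      using assms(2) by simp
    from image_mset_eq_imp_bij_betw[OF assms(3,4) this] obtain \<beta> where
      \<beta>: "bij_betw \<beta> (pverts X) (pverts Y)" "\<forall>v\<in>pverts X. \<forall>a<length x.
        wl_coloring X i (x[a := v]) = wl_coloring Y i (y[a := \<beta> v])"
      by (auto simp: map_eq_conv)
    \<comment> \<open>Restriction moves the bijection into the finite extensional function space
      from which the choice is made.\<close>
    then show "\<exists>\<beta>\<in>pverts X \<rightarrow>\<^sub>E pverts Y. ?P i \<beta>"
      using bij_betwE[OF \<beta>(1)]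
      by (intro bexI[of _ "restrict \<beta> (pverts X)"]) (auto cong: bij_betw_cong)
  next
    fix i j \<beta> assume "?P i \<beta>" "j \<le> i"
    then show "?P j \<beta>" by (blast intro: wl_coloring_eq_mono)
  qed
  then show ?thesis unfolding wl_indist_def by blast
qed

section \<open>Equitable relations\<close>

text \<open>
  Both "same color after color refinement" and the graph of an isomorphism are equitable, which is
  why one analysis yields identification as well as the count of isomorphism classes.
\<close>

definition equitable_rel :: "'a pair_pre_digraph \<Rightarrow> 'b pair_pre_digraph \<Rightarrow> ('a \<Rightarrow> 'b \<Rightarrow> bool) \<Rightarrow> bool" where
  "equitable_rel X Y R \<longleftrightarrow> (\<forall>x y. R x y \<longrightarrow> x \<in> pverts X \<and> y \<in> pverts Y \<and>
    (\<exists>\<beta>. bij_betw \<beta> (pverts X) (pverts Y) \<and>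
      (\<forall>v\<in>pverts X. R v (\<beta> v) \<and> ((x, v) \<in> parcs X \<longleftrightarrow> (y, \<beta> v) \<in> parcs Y))))"

lemma equitable_relD:
  assumes "equitable_rel X Y R" "R x y"
  shows "\<exists>\<beta>. bij_betw \<beta> (pverts X) (pverts Y) \<and>
    (\<forall>v\<in>pverts X. R v (\<beta> v) \<and> ((x, v) \<in> parcs X \<longleftrightarrow> (y, \<beta> v) \<in> parcs Y))"
  using assms unfolding equitable_rel_def by blast

lemma equitable_rel_verts:
  assumes "equitable_rel X Y R" "R x y"
  shows "x \<in> pverts X" "y \<in> pverts Y"
  using assms unfolding equitable_rel_def by blast+

lemma equitable_rel_iso:
  assumes "bij_betw f (pverts X) (pverts Y)"
    and "\<And>a b. a \<in> pverts X \<Longrightarrow> b \<in> pverts X \<Longrightarrow> (a, b) \<in> parcs X \<longleftrightarrow> (f a, f b) \<in> parcs Y"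
  shows "equitable_rel X Y (\<lambda>x y. x \<in> pverts X \<and> y = f x)"
  using assms bij_betwE[OF assms(1)] unfolding equitable_rel_def by blast

text \<open>The last position moves over the vertices, the others hold the base. Overwriting the
  last entry by \<open>v\<close> yields the related pair \<open>v\<close>, \<open>\<beta> v\<close>;
  overwriting entry 0 instead keeps \<open>x\<close> in place, so the atomic color compares the
  adjacency of \<open>x\<close> and \<open>v\<close>. Thus one position beyond the base suffices for
  color refinement.\<close>

lemma equitable_rel_wl_indist:
  assumes "pair_graph X" "pair_graph Y" "bs \<noteq> []" "length cs = length bs"
  shows "equitable_rel X Y (\<lambda>x y. x \<in> pverts X \<and> y \<in> pverts Y \<and> wl_indist X (bs @ [x]) Y (cs @ [y]))"
  unfolding equitable_rel_def
proof (intro allI impI, elim conjE, intro conjI)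
  interpret X: pair_graph X by fact
  interpret Y: pair_graph Y by fact
  fix x y assume xy: "x \<in> pverts X" "y \<in> pverts Y" and ind: "wl_indist X (bs @ [x]) Y (cs @ [y])"
  let ?k = "length bs"
  obtain \<beta> where \<beta>: "bij_betw \<beta> (pverts X) (pverts Y)"
    and ind': "\<And>v a. v \<in> pverts X \<Longrightarrow> a < Suc ?k \<Longrightarrow>
      wl_indist X ((bs @ [x])[a := v]) Y ((cs @ [y])[a := \<beta> v])"
    using wl_indist_bij[OF ind] assms(4) X.pair_finite_verts Y.pair_finite_verts by auto
  have "wl_indist X (bs @ [v]) Y (cs @ [\<beta> v])" if "v \<in> pverts X" for v
    using ind'[OF that, of ?k] assms(4) by (metis lessI list_update_length)
  moreover have "(x, v) \<in> parcs X \<longleftrightarrow> (y, \<beta> v) \<in> parcs Y" if "v \<in> pverts X" for v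
    using wl_indist_atomic(2)[OF ind'[OF that, of 0], of ?k 0] assms(3,4)
    by (cases bs; cases cs) (auto simp: nth_append)
  ultimately show "\<exists>\<beta>. bij_betw \<beta> (pverts X) (pverts Y) \<and>
      (\<forall>v\<in>pverts X. (v \<in> pverts X \<and> \<beta> v \<in> pverts Y \<and> wl_indist X (bs @ [v]) Y (cs @ [\<beta> v])) \<and>
        ((x, v) \<in> parcs X \<longleftrightarrow> (y, \<beta> v) \<in> parcs Y))"
    using \<beta> bij_betwE[OF \<beta>] by blast
qed

text \<open>An indistinguishable tuple of \<open>Y\<close> supplies the base \<open>cs\<close>. By
  discreteness no \<open>y\<close> has two partners, so \<open>R\<close> is the graph of a bijection
  \<open>f\<close>. The bijections that equitability provides at the single vertices then all agree
  with \<open>f\<close>, which makes \<open>f\<close> an isomorphism.\<close>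

lemma wl_identified_if_discrete:
  fixes X :: "'a pair_pre_digraph"
  assumes X: "pair_graph X" and bs: "bs \<noteq> []" "set bs \<subseteq> pverts X"
    and discrete: "\<And>x y. x \<in> pverts X \<Longrightarrow> y \<in> pverts X \<Longrightarrow>
      wl_indist X (bs @ [x]) X (bs @ [y]) \<Longrightarrow> x = y"
  shows "wl_identified (Suc (length bs)) X"
  unfolding wl_identified_def
proof (intro allI impI, elim conjE)
  fix Y :: "nat pair_pre_digraph"
  assume Y: "pair_graph Y" and eq: "wl_equivalent (Suc (length bs)) X Y"
  interpret X: pair_graph X by fact
  interpret Y: pair_graph Y by fact
  \<comment> \<open>The vertex \<open>hd bs\<close> only fills the last position.\<close>
  have "bs @ [hd bs] \<in> tuples (Suc (length bs)) X" using bs by (auto simp: tuples_def)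
  then obtain z where z: "z \<in> tuples (Suc (length bs)) Y" "wl_indist X (bs @ [hd bs]) Y z"
    using wl_equivalent_imp_indist[OF eq] Y.pair_finite_verts by blast
  define cs where "cs = butlast z"
  have len: "length cs = length bs" using z by (auto simp: cs_def tuples_def)
  have "z \<noteq> []" using z(1) by (auto simp: tuples_def)
  then have zc: "z = cs @ [last z]" by (simp add: cs_def)
  have last: "last z \<in> pverts Y" using z(1) last_in_set[OF \<open>z \<noteq> []\<close>] by (auto simp: tuples_def)
  define R where "R x y \<longleftrightarrow> x \<in> pverts X \<and> y \<in> pverts Y \<and> wl_indist X (bs @ [x]) Y (cs @ [y])" for x y
  have eR: "equitable_rel X Y R"
    using equitable_rel_wl_indist[OF X Y bs(1) len] unfolding R_def .
  have base: "R (hd bs) (last z)" using z(2) zc last bs by (auto simp: R_def)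
  then obtain f where f: "bij_betw f (pverts X) (pverts Y)" "\<And>v. v \<in> pverts X \<Longrightarrow> R v (f v)"
    using equitable_relD[OF eR base] by blast
  have inj: "x = x'" if "R x y" "R x' y" for x x' y
    using that discrete[of x x'] by (simp add: R_def wl_indist_def)
  have R: "y = f x" if xy: "R x y" for x y
  proof -
    obtain x' where "x' \<in> pverts X" "y = f x'"
      using f(1) equitable_rel_verts(2)[OF eR xy] by (auto simp: bij_betw_def)
    then show ?thesis using inj[OF xy, of x'] f(2) by auto
  qed
  have "(a, b) \<in> parcs X \<longleftrightarrow> (f a, f b) \<in> parcs Y" if ab: "a \<in> pverts X" "b \<in> pverts X" for a b
  proof -
    obtain \<beta> where \<beta>: "\<forall>v\<in>pverts X. R v (\<beta> v) \<and> ((a, v) \<in> parcs X \<longleftrightarrow> (f a, \<beta> v) \<in> parcs Y)"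
      using equitable_relD[OF eR f(2)[OF ab(1)]] by blast
    with ab(2) R[of b "\<beta> b"] show ?thesis by simp
  qed
  then show "graph_iso X Y" using graph_iso_iff[OF X Y] f(1) by blast
qed

text \<open>For \<open>R\<close> the equality of refined colors, these are matching unions of color
  classes. The closure lemmas below build the lines from the individualized points.\<close>

definition invariant_pair :: "('a \<Rightarrow> 'b \<Rightarrow> bool) \<Rightarrow> 'a set \<Rightarrow> 'b set \<Rightarrow> bool" where
  "invariant_pair R S T \<longleftrightarrow> (\<forall>x y. R x y \<longrightarrow> (x \<in> S \<longleftrightarrow> y \<in> T))"

lemma invariant_pair_boolean:
  assumes "invariant_pair R S T" "invariant_pair R S' T'"
  shows "invariant_pair R (S \<inter> S') (T \<inter> T')" "invariant_pair R (S \<union> S') (T \<union> T')"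
    "invariant_pair R (S - S') (T - T')"
  using assms unfolding invariant_pair_def by blast+

text \<open>The bijection attached to a related pair maps the neighbors in \<open>S\<close> onto
  those in \<open>T\<close>. The predicate \<open>P\<close> later asks for exactly one neighbor or
  for at least two.\<close>

lemma invariant_pair_count:
  assumes R: "equitable_rel X Y R" and inv: "invariant_pair R S T"
    and "S \<subseteq> pverts X" "T \<subseteq> pverts Y"
  shows "invariant_pair R {x. P (card {v\<in>S. (x, v) \<in> parcs X})} {y. P (card {v\<in>T. (y, v) \<in> parcs Y})}"
proof -
  have "card {v\<in>S. (x, v) \<in> parcs X} = card {v\<in>T. (y, v) \<in> parcs Y}" if xy: "R x y" for x y
  proof -
    obtain \<beta> where \<beta>: "bij_betw \<beta> (pverts X) (pverts Y)" "\<And>v. v \<in> pverts X \<Longrightarrow> R v (\<beta> v)"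
      "\<And>v. v \<in> pverts X \<Longrightarrow> (x, v) \<in> parcs X \<longleftrightarrow> (y, \<beta> v) \<in> parcs Y"
      using equitable_relD[OF R xy] by blast
    have mem: "v \<in> S \<longleftrightarrow> \<beta> v \<in> T" if "v \<in> pverts X" for v
      using \<beta>(2)[OF that] inv by (simp add: invariant_pair_def)
    have "\<beta> ` {v\<in>S. (x, v) \<in> parcs X} = {v\<in>T. (y, v) \<in> parcs Y}"
    proof
      show "\<beta> ` {v\<in>S. (x, v) \<in> parcs X} \<subseteq> {v\<in>T. (y, v) \<in> parcs Y}"
        using mem \<beta>(3) assms(3) by blast
      show "{v\<in>T. (y, v) \<in> parcs Y} \<subseteq> \<beta> ` {v\<in>S. (x, v) \<in> parcs X}"
      proof
        fix w assume w: "w \<in> {v\<in>T. (y, v) \<in> parcs Y}"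
        then obtain v where "v \<in> pverts X" "w = \<beta> v"
          using \<beta>(1) assms(4) by (auto simp: bij_betw_def)
        then show "w \<in> \<beta> ` {v\<in>S. (x, v) \<in> parcs X}" using w mem \<beta>(3) by blast
      qed
    qed
    moreover have "inj_on \<beta> {v\<in>S. (x, v) \<in> parcs X}"
      using \<beta>(1) assms(3) by (auto simp: bij_betw_def intro: inj_on_subset)
    ultimately show ?thesis
      using card_image[of \<beta> "{v\<in>S. (x, v) \<in> parcs X}"] by argo
  qed
  then show ?thesis by (auto simp: invariant_pair_def)
qed

text \<open>Adjacency to \<open>p\<close> means having exactly one neighbor in
  \<open>{p}\<close>.\<close>

lemma invariant_pair_neighbors:
  assumes "equitable_rel X Y R" "invariant_pair R {p} {q}" "p \<in> pverts X" "q \<in> pverts Y"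
  shows "invariant_pair R {x. (x, p) \<in> parcs X} {y. (y, q) \<in> parcs Y}"
proof -
  have *: "card {v\<in>{w}. (x, v) \<in> E} = 1 \<longleftrightarrow> (x, w) \<in> E" for x w and E :: "('c \<times> 'c) set"
  proof -
    have "{v\<in>{w}. (x, v) \<in> E} = (if (x, w) \<in> E then {w} else {})" by auto
    then show ?thesis by simp
  qed
  show ?thesis
    using invariant_pair_count[OF assms(1,2), of "\<lambda>k. k = 1"] assms(3,4) by (simp only: *) simp
qed

section \<open>Nets\<close>

text \<open>An r-net of order n in coordinates: \<open>\<rho> i p\<close> is the number of the line
  of class \<open>i\<close> through \<open>p\<close>.\<close>

locale net =
  fixes V :: "'a set" and \<rho> :: "nat \<Rightarrow> 'a \<Rightarrow> nat" and r n :: nat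
  assumes finite_points: "finite V" and two_classes: "2 \<le> r"
    and coord_less: "\<And>i p. i < r \<Longrightarrow> p \<in> V \<Longrightarrow> \<rho> i p < n"
    and meet: "\<And>i j u v. i < r \<Longrightarrow> j < r \<Longrightarrow> i \<noteq> j \<Longrightarrow> u < n \<Longrightarrow> v < n \<Longrightarrow>
      \<exists>!p. p \<in> V \<and> \<rho> i p = u \<and> \<rho> j p = v"
begin

definition graph :: "'a pair_pre_digraph" where
  "graph = \<lparr>pverts = V, parcs = {(p, q). p \<in> V \<and> q \<in> V \<and> p \<noteq> q \<and> (\<exists>i<r. \<rho> i p = \<rho> i q)}\<rparr>"

definition line :: "nat \<Rightarrow> nat \<Rightarrow> 'a set" where
  "line i u = {p \<in> V. \<rho> i p = u}"

lemma pverts_graph [simp]: "pverts graph = V"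
  by (simp add: graph_def)

lemma arc_iff: "(p, q) \<in> parcs graph \<longleftrightarrow> p \<in> V \<and> q \<in> V \<and> p \<noteq> q \<and> (\<exists>i<r. \<rho> i p = \<rho> i q)"
  by (simp add: graph_def)

lemma pair_graph: "pair_graph graph"
proof -
  have "finite (parcs graph)"
    by (rule finite_subset[of _ "V \<times> V"]) (auto simp: graph_def finite_points)
  moreover have "symmetric graph"
    unfolding symmetric_def with_proj_simps by (auto simp: sym_def graph_def)
  ultimately show ?thesis
    by unfold_locales (auto simp: graph_def finite_points)
qed

lemma collinear_unique:
  assumes "p \<in> V" "q \<in> V" "i < r" "j < r" "i \<noteq> j" "\<rho> i p = \<rho> i q" "\<rho> j p = \<rho> j q"
  shows "p = q"
  using meet[OF assms(3-5) coord_less[OF assms(3,1)] coord_less[OF assms(4,1)]] assms by metis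

text \<open>The coordinate of any other class numbers the points of a line bijectively.\<close>

lemma card_line:
  assumes "i < r" "u < n"
  shows "card (line i u) = n"
proof -
  obtain j where j: "j < r" "j \<noteq> i"
    using two_classes by (metis One_nat_def Suc_1 less_le_trans lessI zero_less_Suc zero_neq_one)
  have "bij_betw (\<rho> j) (line i u) {..<n}"
  proof (rule bij_betw_imageI)
    show "inj_on (\<rho> j) (line i u)"
      using collinear_unique[of _ _ i j] assms j by (auto simp: inj_on_def line_def)
    show "\<rho> j ` line i u = {..<n}"
    proof
      show "\<rho> j ` line i u \<subseteq> {..<n}" using coord_less[OF j(1)] by (auto simp: line_def)
      show "{..<n} \<subseteq> \<rho> j ` line i u"
      proof
        fix v assume "v \<in> {..<n}"
        then obtain p where "p \<in> V" "\<rho> i p = u" "\<rho> j p = v"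
          using meet[OF assms(1) j(1) j(2)[symmetric] assms(2), of v] by auto
        then show "v \<in> \<rho> j ` line i u" by (auto simp: line_def)
      qed
    qed
  qed
  then show ?thesis by (simp add: bij_betw_same_card)
qed

lemma finite_line: "finite (line i u)"
  by (simp add: line_def finite_points)

lemma card_points: "card V = n\<^sup>2"
proof -
  have "0 < r" "1 < r" using two_classes by auto
  have "bij_betw (\<lambda>p. (\<rho> 0 p, \<rho> 1 p)) V ({..<n} \<times> {..<n})"
  proof (rule bij_betw_imageI)
    show "inj_on (\<lambda>p. (\<rho> 0 p, \<rho> 1 p)) V"
      using collinear_unique[of _ _ 0 1] \<open>0 < r\<close> \<open>1 < r\<close> by (auto simp: inj_on_def)
    show "(\<lambda>p. (\<rho> 0 p, \<rho> 1 p)) ` V = {..<n} \<times> {..<n}"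
    proof
      show "(\<lambda>p. (\<rho> 0 p, \<rho> 1 p)) ` V \<subseteq> {..<n} \<times> {..<n}"
        using coord_less \<open>0 < r\<close> \<open>1 < r\<close> by auto
      show "{..<n} \<times> {..<n} \<subseteq> (\<lambda>p. (\<rho> 0 p, \<rho> 1 p)) ` V"
      proof
        fix w assume "w \<in> {..<n} \<times> {..<n}"
        then obtain u v where w: "w = (u, v)" "u < n" "v < n" by auto
        then obtain p where "p \<in> V" "\<rho> 0 p = u" "\<rho> 1 p = v"
          using meet[OF \<open>0 < r\<close> \<open>1 < r\<close> zero_neq_one, of u v] by auto
        then show "w \<in> (\<lambda>p. (\<rho> 0 p, \<rho> 1 p)) ` V" using w(1) by force
      qed
    qed
  qed
  then show ?thesis by (simp add: bij_betw_same_card power2_eq_square)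
qed

text \<open>The points correspond to ordered pairs of distinct classes: \<open>(i, j)\<close> gives
  the meeting point of the line of class \<open>i\<close> through \<open>p\<close> and the line of
  class \<open>j\<close> through \<open>q\<close>. A point arising from two pairs would share two
  lines with \<open>p\<close> or with \<open>q\<close>, hence be \<open>p\<close> or
  \<open>q\<close>, against the assumption that these differ in all coordinates from
  \<open>I\<close>.\<close>

lemma card_doubly_collinear:
  assumes "p \<in> V" "q \<in> V" "I \<subseteq> {..<r}" "\<And>i. i \<in> I \<Longrightarrow> \<rho> i p \<noteq> \<rho> i q"
  shows "card {v\<in>V. (\<exists>i\<in>I. \<rho> i v = \<rho> i p) \<and> (\<exists>j\<in>I. \<rho> j v = \<rho> j q)} = card I * (card I - 1)"
    (is "card ?M = _")
proof -
  define D where "D = I \<times> I - (\<lambda>i. (i, i)) ` I"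
  define f where "f = (\<lambda>(i, j). THE v. v \<in> V \<and> \<rho> i v = \<rho> i p \<and> \<rho> j v = \<rho> j q)"
  have fin: "finite I" using assms(3) finite_subset by blast
  have D: "i \<in> I" "j \<in> I" "i < r" "j < r" "i \<noteq> j" if "(i, j) \<in> D" for i j
    using that assms(3) by (auto simp: D_def)
  have ex1: "\<exists>!v. v \<in> V \<and> \<rho> i v = \<rho> i p \<and> \<rho> j v = \<rho> j q" if "(i, j) \<in> D" for i j
    using D[OF that] assms(1,2) by (intro meet coord_less)
  have f: "f (i, j) \<in> V" "\<rho> i (f (i, j)) = \<rho> i p" "\<rho> j (f (i, j)) = \<rho> j q" if "(i, j) \<in> D" for i j
    using theI'[OF ex1[OF that]] by (auto simp: f_def)
  have "inj_on f D"
  proof (rule inj_onI)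
    fix a b assume ab: "a \<in> D" "b \<in> D" "f a = f b"
    obtain i j k l where ij: "a = (i, j)" "b = (k, l)" by fastforce
    note a = f[OF ab(1)[unfolded ij(1)]] D[OF ab(1)[unfolded ij(1)]]
    note b = f[OF ab(2)[unfolded ij(2)]] D[OF ab(2)[unfolded ij(2)]]
    have eq: "f (i, j) = f (k, l)" using ab(3) ij by simp
    have "i = k"
    proof (rule ccontr)
      assume "i \<noteq> k"
      then have "f (i, j) = p"
        using collinear_unique[of "f (i, j)" p i k] a b eq assms(1) by metis
      then show False using a assms(4) by metis
    qed
    moreover have "j = l"
    proof (rule ccontr)
      assume "j \<noteq> l"
      then have "f (i, j) = q"
        using collinear_unique[of "f (i, j)" q j l] a b eq assms(2) by metis
      then show False using a assms(4) by metis
    qed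
    ultimately show "a = b" using ij by simp
  qed
  moreover have "f ` D = ?M"
  proof
    show "f ` D \<subseteq> ?M"
    proof
      fix w assume "w \<in> f ` D"
      then obtain i j where "(i, j) \<in> D" "w = f (i, j)" by auto
      then show "w \<in> ?M" using f[of i j] D[of i j] by blast
    qed
    show "?M \<subseteq> f ` D"
    proof
      fix v assume "v \<in> ?M"
      then obtain i j where v: "v \<in> V" "i \<in> I" "j \<in> I" "\<rho> i v = \<rho> i p" "\<rho> j v = \<rho> j q" by blast
      then have "(i, j) \<in> D" using assms(4)[of i] by (auto simp: D_def)
      moreover have "f (i, j) = v"
        unfolding f_def using ex1[OF calculation] v by (auto intro: the1_equality)
      ultimately show "v \<in> f ` D" by blast
    qed
  qed
  ultimately have "card ?M = card D" using card_image by metis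
  also have "\<dots> = card I * card I - card I"
    unfolding D_def using fin
    by (subst card_Diff_subset) (auto simp: card_cartesian_product card_image inj_on_def)
  finally show ?thesis by (simp add: diff_mult_distrib2)
qed

lemma card_common_neighbors_self:
  assumes "p \<in> V"
  shows "card (common_neighbors graph p p) = r * (n - 1)"
proof -
  have "common_neighbors graph p p = (\<Union>i<r. line i (\<rho> i p) - {p})"
    using assms by (auto simp: common_neighbors_def arc_iff line_def)
  also have "card \<dots> = (\<Sum>i<r. card (line i (\<rho> i p) - {p}))"
    using collinear_unique assms by (intro card_UN_disjoint) (auto simp: line_def finite_points)
  also have "\<dots> = (\<Sum>i<r. n - 1)"
    using assms by (intro sum.cong refl, subst card_Diff_singleton)
      (auto simp: card_line coord_less, auto simp: line_def)
  finally show ?thesis by simp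
qed

text \<open>A common neighbor off the common line must be joined to both points in classes other
  than \<open>k\<close>; conversely \<open>p\<close> and \<open>q\<close> are outside the second set
  because they agree in class \<open>k\<close> only.\<close>

lemma common_neighbors_collinear:
  assumes "p \<in> V" "q \<in> V" "p \<noteq> q" "k < r" "\<rho> k p = \<rho> k q"
  shows "common_neighbors graph p q = (line k (\<rho> k p) - {p, q}) \<union>
    {v\<in>V. (\<exists>i\<in>{..<r} - {k}. \<rho> i v = \<rho> i p) \<and> (\<exists>j\<in>{..<r} - {k}. \<rho> j v = \<rho> j q)}"
    (is "_ = ?L \<union> ?M")
proof
  have ne: "\<rho> i p \<noteq> \<rho> i q" if "i < r" "i \<noteq> k" for i
    using collinear_unique[OF assms(1,2) that(1) assms(4) that(2)] assms(3,5) by blast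
  show "?L \<union> ?M \<subseteq> common_neighbors graph p q"
    using assms ne by (fastforce simp: common_neighbors_def arc_iff line_def)
  show "common_neighbors graph p q \<subseteq> ?L \<union> ?M"
  proof
    fix v assume "v \<in> common_neighbors graph p q"
    then obtain i j where v: "v \<in> V" "v \<noteq> p" "v \<noteq> q" "i < r" "j < r" "\<rho> i p = \<rho> i v" "\<rho> j q = \<rho> j v"
      by (auto simp: common_neighbors_def arc_iff)
    show "v \<in> ?L \<union> ?M"
    proof (cases "\<rho> k v = \<rho> k p")
      case True
      then show ?thesis using v by (auto simp: line_def)
    next
      case False
      then have "i \<noteq> k" "j \<noteq> k" using v assms(5) by auto
      then show ?thesis using v by force
    qed
  qed
qed

text \<open>An adjacent pair gets \<open>n - 2\<close> common neighbors from its line and the rest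
  from the other \<open>r - 1\<close> classes; a nonadjacent pair gets all of them from the count
  over all \<open>r\<close> classes.\<close>

lemma strongly_regular:
  "strongly_regular graph (n\<^sup>2) (r * (n - 1)) (n - 2 + (r - 1) * (r - 2)) (r * (r - 1))"
  unfolding strongly_regular_def pverts_graph
proof (intro conjI ballI pair_graph card_points)
  fix p q assume pq: "p \<in> V" "q \<in> V"
  consider (eq) "p = q" | (adj) "p \<noteq> q" "(p, q) \<in> parcs graph" | (nonadj) "p \<noteq> q" "(p, q) \<notin> parcs graph"
    by blast
  then show "card (common_neighbors graph p q) = (if p = q then r * (n - 1)
      else if (p, q) \<in> parcs graph then n - 2 + (r - 1) * (r - 2) else r * (r - 1))"
  proof cases
    case eq
    then show ?thesis using card_common_neighbors_self pq by simp
  next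
    case adj
    then obtain k where k: "k < r" "\<rho> k p = \<rho> k q" by (auto simp: arc_iff)
    let ?I = "{..<r} - {k}"
    let ?M = "{v\<in>V. (\<exists>i\<in>?I. \<rho> i v = \<rho> i p) \<and> (\<exists>j\<in>?I. \<rho> j v = \<rho> j q)}"
    have ne: "\<rho> i p \<noteq> \<rho> i q" if "i < r" "i \<noteq> k" for i
      using collinear_unique[OF pq that(1) k(1) that(2)] adj(1) k(2) by blast
    have "card ?M = card ?I * (card ?I - 1)"
      using ne pq by (intro card_doubly_collinear) auto
    then have M: "card ?M = (r - 1) * (r - 2)" using k(1) by (simp add: numeral_2_eq_2)
    have "(line k (\<rho> k p) - {p, q}) \<inter> ?M = {}"
      using collinear_unique[OF pq(1)] k by (fastforce simp: line_def)
    then have "card (common_neighbors graph p q) = card (line k (\<rho> k p) - {p, q}) + card ?M"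
      unfolding common_neighbors_collinear[OF pq adj(1) k]
      by (intro card_Un_disjoint) (auto simp: finite_line finite_points)
    moreover have "card (line k (\<rho> k p) - {p, q}) = n - 2"
      using pq k adj(1) by (subst card_Diff_subset) (auto simp: card_line coord_less, auto simp: line_def)
    ultimately show ?thesis using M adj by simp
  next
    case nonadj
    then have ne: "\<rho> i p \<noteq> \<rho> i q" if "i < r" for i using that pq by (auto simp: arc_iff)
    have "common_neighbors graph p q =
        {v\<in>V. (\<exists>i\<in>{..<r}. \<rho> i v = \<rho> i p) \<and> (\<exists>j\<in>{..<r}. \<rho> j v = \<rho> j q)}"
      (is "_ = ?M")
    proof (rule set_eqI)
      fix v
      have "(\<exists>i<r. \<rho> i x = \<rho> i v) \<longleftrightarrow> (\<exists>i\<in>{..<r}. \<rho> i v = \<rho> i x)" for x by force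
      then show "v \<in> common_neighbors graph p q \<longleftrightarrow> v \<in> ?M"
        using pq ne by (auto simp: common_neighbors_def arc_iff)
    qed
    then show ?thesis
      using card_doubly_collinear[OF pq, of "{..<r}"] ne nonadj by simp
  qed
qed

end

section \<open>Recognizing lines of 3-nets from adjacency\<close>

locale three_net = net V \<rho> 3 n for V :: "'a set" and \<rho> n +
  assumes five_le: "5 \<le> n"
begin

text \<open>
  Of the common neighbors of \<open>p\<close> and \<open>q\<close>, the two off their line have at most one neighbor among
  the others, the \<open>n - 2\<close> on the line at least \<open>n - 3\<close>.
\<close>

lemma line_eq_through_two:
  fixes p q
  defines "T \<equiv> {x. (x, p) \<in> parcs graph} \<inter> {x. (x, q) \<in> parcs graph}"
  assumes "i < 3" "p \<in> line i u" "q \<in> line i u" "p \<noteq> q"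
  shows "line i u = ({p} \<union> {q}) \<union> (T \<inter> {x. 2 \<le> card {v\<in>T. (x, v) \<in> parcs graph}})"
proof -
  define M where "M = {v\<in>V. (\<exists>a\<in>{..<3} - {i}. \<rho> a v = \<rho> a p) \<and> (\<exists>b\<in>{..<3} - {i}. \<rho> b v = \<rho> b q)}"
  have pq: "p \<in> V" "q \<in> V" "\<rho> i p = u" "\<rho> i q = u" using assms by (auto simp: line_def)
  have "T = common_neighbors graph p q"
    by (auto simp: T_def common_neighbors_def arc_iff)
  then have T: "T = (line i u - {p, q}) \<union> M"
    using common_neighbors_collinear[OF pq(1,2) assms(5,2)] pq by (simp add: M_def)
  have ne: "\<rho> a p \<noteq> \<rho> a q" if "a < 3" "a \<noteq> i" for a
    using collinear_unique[OF pq(1,2) that(1) assms(2) that(2)] assms(5) pq by metis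
  have "card M = card ({..<3} - {i}) * (card ({..<3} - {i}) - 1)"
    unfolding M_def using ne pq by (intro card_doubly_collinear) auto
  then have M: "card M = 2" "finite M"
    using assms(2) by (auto simp: M_def finite_points)
  have on: "2 \<le> card {v\<in>T. (x, v) \<in> parcs graph}" if x: "x \<in> line i u - {p, q}" for x
  proof -
    have "line i u - {p, q, x} \<subseteq> {v\<in>T. (x, v) \<in> parcs graph}"
      using x assms(2) by (auto simp: T line_def arc_iff)
    moreover have "finite T" by (simp add: T M finite_line)
    ultimately have "card (line i u - {p, q, x}) \<le> card {v\<in>T. (x, v) \<in> parcs graph}"
      by (intro card_mono) auto
    moreover have "u < n" using coord_less[OF assms(2) pq(1)] pq by simp
    then have "card (line i u - {p, q, x}) = n - card {p, q, x}"
      using assms x card_line[OF assms(2)] by (subst card_Diff_subset) auto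
    moreover have "card {p, q, x} = 3" using assms(5) x by auto
    \<comment> \<open>The line contributes at least \<open>n - 3\<close> neighbors;
      \<open>five_le\<close> lifts this above the bound 1 that holds off the line.\<close>
    ultimately show ?thesis using five_le by simp
  qed
  have off: "card {v\<in>T. (x, v) \<in> parcs graph} \<le> 1" if x: "x \<in> M" "x \<notin> line i u" for x
  proof -
    obtain a b where ab: "x \<in> V" "a < 3" "b < 3" "a \<noteq> i" "b \<noteq> i" "\<rho> a x = \<rho> a p" "\<rho> b x = \<rho> b q"
      using x(1) by (auto simp: M_def)
    then have "a \<noteq> b" using ne by metis
    \<comment> \<open>The classes \<open>a\<close> and \<open>b\<close> are the two classes other
      than \<open>i\<close>. A point of the line joined to \<open>x\<close> in class
      \<open>a\<close> coincides with \<open>p\<close>, one joined in class \<open>b\<close> with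
      \<open>q\<close>.\<close>
    have "(x, v) \<notin> parcs graph" if v: "v \<in> line i u - {p, q}" for v
    proof
      assume "(x, v) \<in> parcs graph"
      then obtain k where k: "k < 3" "\<rho> k x = \<rho> k v" by (auto simp: arc_iff)
      have V: "v \<in> V" "\<rho> i v = u" using v by (auto simp: line_def)
      have "k \<noteq> i" using x(2) ab(1) k(2) V by (auto simp: line_def)
      then have "k = a \<or> k = b" using ab \<open>a \<noteq> b\<close> assms(2) k(1) by presburger
      then have "v = p \<or> v = q"
        using collinear_unique[OF V(1) pq(1) ab(2) assms(2) ab(4)]
          collinear_unique[OF V(1) pq(2) ab(3) assms(2) ab(5)] ab k V pq by metis
      then show False using v by blast
    qed
    then have "{v\<in>T. (x, v) \<in> parcs graph} \<subseteq> M - {x}"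
      by (auto simp: T arc_iff)
    then have "card {v\<in>T. (x, v) \<in> parcs graph} \<le> card (M - {x})"
      using M by (intro card_mono) auto
    then show ?thesis using M x(1) by simp
  qed
  show ?thesis
  proof (rule set_eqI)
    fix x
    show "x \<in> line i u \<longleftrightarrow>
      x \<in> ({p} \<union> {q}) \<union> (T \<inter> {x. 2 \<le> card {v\<in>T. (x, v) \<in> parcs graph}})"
    proof (cases "x \<in> line i u")
      case True
      then show ?thesis using on[of x] by (auto simp: T)
    next
      case False
      then have "x \<noteq> p" "x \<noteq> q" using assms by auto
      moreover have "x \<in> M" if "x \<in> T" using that False by (auto simp: T)
      ultimately show ?thesis using False off[of x] by auto
    qed
  qed
qed

text \<open>The neighbors of \<open>p\<close> are spread over its three lines, which meet pairwise
  in \<open>p\<close> alone; \<open>p\<close> is added back because it is not its own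
  neighbor.\<close>

lemma third_line_eq:
  assumes "p \<in> V" "i < 3" "j < 3" "k < 3" "i \<noteq> j" "i \<noteq> k" "j \<noteq> k"
  shows "line k (\<rho> k p) =
    (({x. (x, p) \<in> parcs graph} - line i (\<rho> i p)) - line j (\<rho> j p)) \<union> {p}"
proof (rule set_eqI)
  fix x
  have less: "(\<exists>a<3. P a) \<longleftrightarrow> P i \<or> P j \<or> P k" for P
  proof -
    have "a = i \<or> a = j \<or> a = k" if "a < 3" for a using assms that by presburger
    then show ?thesis using assms by blast
  qed
  show "x \<in> line k (\<rho> k p) \<longleftrightarrow>
    x \<in> (({x. (x, p) \<in> parcs graph} - line i (\<rho> i p)) - line j (\<rho> j p)) \<union> {p}"
    using collinear_unique[of x p k i] collinear_unique[of x p k j] assms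
    by (auto simp: line_def arc_iff less)
qed

end

text \<open>Covers two cases: one net taken twice with \<open>R\<close> the equality of refined
  colors, and two nets with \<open>R\<close> the graph of an isomorphism.\<close>

locale three_net_pair = X: three_net V \<rho> n + Y: three_net V' \<rho>' n
  for V :: "'a set" and \<rho> and V' :: "'b set" and \<rho>' and n +
  fixes R :: "'a \<Rightarrow> 'b \<Rightarrow> bool"
  assumes equitable: "equitable_rel X.graph Y.graph R"
begin

text \<open>The formula of \<open>line_eq_through_two\<close> consists of neighborhoods, Boolean
  operations and one count, all of which preserve invariant pairs.\<close>

lemma invariant_pair_line_through_two:
  assumes "i < 3" "p \<in> X.line i u" "q \<in> X.line i u" "p \<noteq> q"
    "p' \<in> Y.line i u'" "q' \<in> Y.line i u'" "p' \<noteq> q'"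
    and inv: "invariant_pair R {p} {p'}" "invariant_pair R {q} {q'}"
  shows "invariant_pair R (X.line i u) (Y.line i u')"
proof -
  let ?T = "{x. (x, p) \<in> parcs X.graph} \<inter> {x. (x, q) \<in> parcs X.graph}"
  let ?T' = "{x. (x, p') \<in> parcs Y.graph} \<inter> {x. (x, q') \<in> parcs Y.graph}"
  have pts: "p \<in> V" "q \<in> V" "p' \<in> V'" "q' \<in> V'"
    using assms by (auto simp: X.line_def Y.line_def)
  have T: "invariant_pair R ?T ?T'"
    using pts by (intro invariant_pair_boolean invariant_pair_neighbors[OF equitable] inv) auto
  show ?thesis
    unfolding X.line_eq_through_two[OF assms(1-4)] Y.line_eq_through_two[OF assms(1,5-7)]
    by (intro invariant_pair_boolean inv T invariant_pair_count[OF equitable T, where P = "\<lambda>k. 2 \<le> k"])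
      (auto simp: X.arc_iff Y.arc_iff)
qed

text \<open>Two recognized lines single out their meeting point; the formula of
  \<open>third_line_eq\<close> then uses recognized sets only.\<close>

lemma invariant_pair_third_line:
  assumes "p \<in> V" "p' \<in> V'" "i < 3" "j < 3" "k < 3" "i \<noteq> j" "i \<noteq> k" "j \<noteq> k"
    and inv: "invariant_pair R (X.line i (\<rho> i p)) (Y.line i (\<rho>' i p'))"
      "invariant_pair R (X.line j (\<rho> j p)) (Y.line j (\<rho>' j p'))"
  shows "invariant_pair R (X.line k (\<rho> k p)) (Y.line k (\<rho>' k p'))"
proof -
  have "X.line i (\<rho> i p) \<inter> X.line j (\<rho> j p) = {p}" "Y.line i (\<rho>' i p') \<inter> Y.line j (\<rho>' j p') = {p'}"
    using assms X.collinear_unique[of _ p i j] Y.collinear_unique[of _ p' i j]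
    by (auto simp: X.line_def Y.line_def)
  then have p: "invariant_pair R {p} {p'}"
    using invariant_pair_boolean(1)[OF inv] by simp
  show ?thesis
    unfolding X.third_line_eq[OF assms(1,3-8)] Y.third_line_eq[OF assms(2,3-8)]
    using assms(1,2) by (intro invariant_pair_boolean invariant_pair_neighbors[OF equitable] inv p) auto
qed

end

section \<open>Latin square graphs\<close>

definition latin_square :: "nat \<Rightarrow> (nat \<Rightarrow> nat \<Rightarrow> nat) \<Rightarrow> bool" where
  "latin_square n L \<longleftrightarrow> (\<forall>i<n. bij_betw (L i) {..<n} {..<n}) \<and> (\<forall>j<n. bij_betw (\<lambda>i. L i j) {..<n} {..<n})"

text \<open>The cell in row \<open>i\<close> and column \<open>j\<close> is the number \<open>i * n + j\<close>.\<close>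

definition cell_coord :: "nat \<Rightarrow> (nat \<Rightarrow> nat \<Rightarrow> nat) \<Rightarrow> nat \<Rightarrow> nat \<Rightarrow> nat" where
  "cell_coord n L k p = (if k = 0 then p div n else if k = 1 then p mod n else L (p div n) (p mod n))"

definition latin_graph :: "nat \<Rightarrow> (nat \<Rightarrow> nat \<Rightarrow> nat) \<Rightarrow> nat pair_pre_digraph" where
  "latin_graph n L = net.graph {..<n * n} (cell_coord n L) 3"

lemma cell_less: "i < n \<Longrightarrow> j < n \<Longrightarrow> i * n + j < n * n" for i j n :: nat
  by (metis div_less_iff_less_mult div_mult_self3 div_less add_0_right gr0I not_less_zero)

text \<open>Carries unique existence over from pairs of row and column to cell numbers.\<close>

lemma ex1_cell:
  fixes n :: nat
  assumes "r < n" "c < n" "P r c" "\<And>r' c'. r' < n \<Longrightarrow> c' < n \<Longrightarrow> P r' c' \<Longrightarrow> r' = r \<and> c' = c"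
  shows "\<exists>!p. p \<in> {..<n * n} \<and> P (p div n) (p mod n)"
proof (rule ex1I[of _ "r * n + c"])
  show "r * n + c \<in> {..<n * n} \<and> P ((r * n + c) div n) ((r * n + c) mod n)"
    using assms(1-3) cell_less by simp
  fix p assume p: "p \<in> {..<n * n} \<and> P (p div n) (p mod n)"
  then have "p div n < n" "p mod n < n"
    using assms(1) by (auto simp: div_less_iff_less_mult)
  then have "p div n = r \<and> p mod n = c" using assms(4) p by blast
  then show "p = r * n + c" using div_mult_mod_eq[of p n] by simp
qed

lemma three_net_latin_square:
  assumes L: "latin_square n L" and n: "5 \<le> n"
  shows "three_net {..<n * n} (cell_coord n L) n"
proof
  have row: "inj_on (L i) {..<n}" "L i ` {..<n} = {..<n}" if "i < n" for i
    using L that by (auto simp: latin_square_def bij_betw_def)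
  have col: "inj_on (\<lambda>i. L i j) {..<n}" "(\<lambda>i. L i j) ` {..<n} = {..<n}" if "j < n" for j
    using L that by (auto simp: latin_square_def bij_betw_def)
  have pn: "p div n < n" "p mod n < n" if "p \<in> {..<n * n}" for p
    using that n by (auto simp: div_less_iff_less_mult)
  show "cell_coord n L i p < n" if "i < 3" "p \<in> {..<n * n}" for i p
    using pn[OF that(2)] row(2)[of "p div n"] by (auto simp: cell_coord_def)
  have rc: "\<exists>!p. p \<in> {..<n * n} \<and> p div n = u \<and> p mod n = v" if "u < n" "v < n" for u v
    using that by (intro ex1_cell[where P = "\<lambda>r c. r = u \<and> c = v"]) auto
  have rs: "\<exists>!p. p \<in> {..<n * n} \<and> p div n = u \<and> L (p div n) (p mod n) = v" if uv: "u < n" "v < n" for u v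
  proof -
    have "v \<in> L u ` {..<n}" using row(2)[OF uv(1)] uv(2) by simp
    then obtain c where "c < n" "L u c = v" by auto
    then show ?thesis
      using uv row(1)[OF uv(1)]
      by (intro ex1_cell[where P = "\<lambda>r c. r = u \<and> L r c = v"]) (auto simp: inj_on_def)
  qed
  have cs: "\<exists>!p. p \<in> {..<n * n} \<and> p mod n = u \<and> L (p div n) (p mod n) = v" if uv: "u < n" "v < n" for u v
  proof -
    have "v \<in> (\<lambda>i. L i u) ` {..<n}" using col(2)[OF uv(1)] uv(2) by simp
    then obtain r where "r < n" "L r u = v" by auto
    then show ?thesis
      using uv col(1)[OF uv(1)]
      by (intro ex1_cell[where P = "\<lambda>r c. c = u \<and> L r c = v"]) (auto simp: inj_on_def)
  qed
  fix i j u v assume ij: "i < 3" "j < (3::nat)" "i \<noteq> j" and uv: "u < n" "v < n"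
  then consider "i = 0" "j = 1" | "i = 1" "j = 0" | "i = 0" "j = 2" | "i = 2" "j = 0"
    | "i = 1" "j = 2" | "i = 2" "j = 1" by linarith
  then show "\<exists>!p. p \<in> {..<n * n} \<and> cell_coord n L i p = u \<and> cell_coord n L j p = v"
  proof cases
    case 1
    then show ?thesis using rc[OF uv] by (simp add: cell_coord_def)
  next
    case 2
    then show ?thesis using rc[OF uv(2,1)] by (simp add: cell_coord_def conj_commute)
  next
    case 3
    then show ?thesis using rs[OF uv] by (simp add: cell_coord_def)
  next
    case 4
    then show ?thesis using rs[OF uv(2,1)] by (simp add: cell_coord_def conj_commute)
  next
    case 5
    then show ?thesis using cs[OF uv] by (simp add: cell_coord_def)
  next
    case 6
    then show ?thesis using cs[OF uv(2,1)] by (simp add: cell_coord_def conj_commute)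
  qed
qed (use n in auto)

section \<open>Recognizing every line from three cells\<close>

definition cyclic_start :: "nat \<Rightarrow> (nat \<Rightarrow> nat \<Rightarrow> nat) \<Rightarrow> bool" where
  "cyclic_start n L \<longleftrightarrow> (\<forall>j<n. L 0 j = j \<and> L j 0 = j \<and> L 1 j = Suc j mod n)"

text \<open>Once all lines are recognized, related cells have equal coordinates: rows and columns
  give \<open>p = q\<close>, symbols the agreement of the squares.\<close>

lemma equitable_rel_cyclic_start:
  assumes L: "latin_square n L" "latin_square n L'" and n: "5 \<le> n"
    and start: "cyclic_start n L" "cyclic_start n L'"
    and R: "equitable_rel (latin_graph n L) (latin_graph n L') R"
    and base: "invariant_pair R {0} {0}" "invariant_pair R {1} {1}" "invariant_pair R {n} {n}"
    and pq: "R p q"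
  shows "p = q" "L (p div n) (p mod n) = L' (p div n) (p mod n)"
proof -
  interpret X: three_net "{..<n * n}" "cell_coord n L" n by (rule three_net_latin_square) fact+
  interpret Y: three_net "{..<n * n}" "cell_coord n L'" n by (rule three_net_latin_square) fact+
  interpret three_net_pair "{..<n * n}" "cell_coord n L" "{..<n * n}" "cell_coord n L'" n R
    by unfold_locales (use R in \<open>simp add: latin_graph_def\<close>)
  define K where "K k u \<longleftrightarrow> invariant_pair R (X.line k u) (Y.line k u)" for k u
  \<comment> \<open>A cell with the same symbol in both squares lies on lines with the same numbers
    there. This is known in advance for the first two rows and the first column, where the walk
    takes place.\<close>
  have third: "K k (cell_coord n L k (r * n + c))"
    if "r < n" "c < n" "L r c = L' r c" "i < 3" "j < 3" "k < 3" "i \<noteq> j" "i \<noteq> k" "j \<noteq> k"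
      "K i (cell_coord n L i (r * n + c))" "K j (cell_coord n L j (r * n + c))" for i j k r c
  proof -
    have "cell_coord n L a (r * n + c) = cell_coord n L' a (r * n + c)" for a
      using that(1-3) by (simp add: cell_coord_def)
    then show ?thesis
      using invariant_pair_third_line[of "r * n + c" "r * n + c" i j k] that cell_less[of r n c]
      by (simp add: K_def)
  qed
  have L0: "L 0 j = j" "L' 0 j = j" "L j 0 = j" "L' j 0 = j" if "j < n" for j
    using start that by (auto simp: cyclic_start_def)
  have L1: "L (Suc 0) j = Suc j" "L' (Suc 0) j = Suc j" if "Suc j < n" for j
    using start that by (auto simp: cyclic_start_def)
  have nn: "Suc 0 < n * n" "n < n * n" using n cell_less[of 0 n 1] cell_less[of 1 n 0] by auto
  \<comment> \<open>Classes 0, 1, 2 are rows, columns and symbols. The base cells (0, 0), (0, 1),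
    (1, 0) have numbers 0, 1, \<open>n\<close>; pairwise they share row 0, column 0 and symbol
    1.\<close>
  have "K 0 0" unfolding K_def
    using n base by (intro invariant_pair_line_through_two[of 0 0 0 1 0 0 1])
      (auto simp: X.line_def Y.line_def cell_coord_def intro: nn)
  have "K 1 0" unfolding K_def
    using n base by (intro invariant_pair_line_through_two[of 1 0 0 n 0 0 n])
      (auto simp: X.line_def Y.line_def cell_coord_def intro: nn)
  have "K 2 1" unfolding K_def
    using n base L0[of 1] L1[of 0] by (intro invariant_pair_line_through_two[of 2 1 1 n 1 1 n])
      (auto simp: X.line_def Y.line_def cell_coord_def intro: nn)
  have "K 2 0"
    using third[of 0 0 0 1 2] n L0[of 0] \<open>K 0 0\<close> \<open>K 1 0\<close> by (simp add: cell_coord_def)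
  have "K 1 1"
    using third[of 0 1 0 2 1] n L0[of 1] \<open>K 0 0\<close> \<open>K 2 1\<close> by (simp add: cell_coord_def)
  have "K 0 1"
    using third[of 1 0 1 2 0] n L0[of 1] \<open>K 1 0\<close> \<open>K 2 1\<close> by (simp add: cell_coord_def)
  have cols: "K 1 j \<and> K 2 j" if "j < n" for j
    using that
  proof (induction j)
    case 0
    then show ?case using \<open>K 1 0\<close> \<open>K 2 0\<close> by simp
  next
    case (Suc j)
    \<comment> \<open>Cell (1, j), in row 1 and column j, carries symbol j + 1. Cell (0, j + 1)
      carries the same symbol and so passes recognition on to column j + 1.\<close>
    have "K 2 (Suc j)"
      using third[of 1 j 0 1 2] n L1[of j] \<open>K 0 1\<close> Suc by (simp add: cell_coord_def)
    moreover have "K 1 (Suc j)"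
      using third[of 0 "Suc j" 0 2 1] n L0[of "Suc j"] \<open>K 0 0\<close> calculation Suc
      by (simp add: cell_coord_def)
    ultimately show ?case by simp
  qed
  \<comment> \<open>Cell (i, 0) lies in column 0 and carries symbol i.\<close>
  have rows: "K 0 i" if "i < n" for i
    using third[of i 0 1 2 0] n L0[OF that] \<open>K 1 0\<close> cols[OF that] that by (simp add: cell_coord_def)
  have K: "K k u" if "k < 3" "u < n" for k u
  proof -
    have "k = 0 \<or> k = 1 \<or> k = 2" using that(1) by auto
    then show ?thesis using rows cols that(2) by blast
  qed
  have p: "p \<in> {..<n * n}" using equitable_rel_verts[OF equitable pq] by simp
  have coord: "cell_coord n L' k q = cell_coord n L k p" if "k < 3" for k
    using K[OF that X.coord_less[OF that p]] pq p
    unfolding K_def invariant_pair_def X.line_def Y.line_def by blast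
  have "p div n = q div n" "p mod n = q mod n"
    using coord[of 0] coord[of 1] by (simp_all add: cell_coord_def)
  then show "p = q" by (metis div_mult_mod_eq)
  then show "L (p div n) (p mod n) = L' (p div n) (p mod n)"
    using coord[of 2] by (simp add: cell_coord_def)
qed

lemma pair_graph_latin_graph:
  assumes "latin_square n L" "5 \<le> n"
  shows "pair_graph (latin_graph n L)"
proof -
  interpret three_net "{..<n * n}" "cell_coord n L" n by (rule three_net_latin_square) fact+
  show ?thesis using pair_graph by (simp add: latin_graph_def)
qed

lemma pverts_latin_graph:
  assumes "latin_square n L" "5 \<le> n"
  shows "pverts (latin_graph n L) = {..<n * n}"
proof -
  interpret three_net "{..<n * n}" "cell_coord n L" n by (rule three_net_latin_square) fact+
  show ?thesis by (simp add: latin_graph_def)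
qed

lemma strongly_regular_latin_graph:
  assumes "latin_square n L" "5 \<le> n"
  shows "strongly_regular (latin_graph n L) (n\<^sup>2) (3 * (n - 1)) n 6"
proof -
  interpret three_net "{..<n * n}" "cell_coord n L" n by (rule three_net_latin_square) fact+
  have "n - 2 + (3 - 1) * (3 - 2) = n" using assms(2) by simp
  then show ?thesis using strongly_regular by (simp add: latin_graph_def)
qed

lemma wl_identified_latin_graph:
  assumes L: "latin_square n L" "cyclic_start n L" and n: "5 \<le> n"
  shows "wl_identified 4 (latin_graph n L)"
proof -
  let ?X = "latin_graph n L" and ?bs = "[0, 1, n]"
  let ?R = "\<lambda>x y. x \<in> pverts ?X \<and> y \<in> pverts ?X \<and> wl_indist ?X (?bs @ [x]) ?X (?bs @ [y])"
  have X: "pair_graph ?X" using pair_graph_latin_graph L(1) n .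
  have R: "equitable_rel ?X ?X ?R" by (intro equitable_rel_wl_indist X) auto
  \<comment> \<open>The atomic color records whether the last entry equals a given base entry, so
    each base point is individualized.\<close>
  have base: "invariant_pair ?R {b} {b}" if b: "b \<in> set ?bs" for b
  proof -
    obtain i where "i < length ?bs" "?bs ! i = b"
      using b unfolding in_set_conv_nth by blast
    then have "i < 3" "?bs ! i = b" by auto
    then have "x = b \<longleftrightarrow> y = b" if xy: "wl_indist ?X (?bs @ [x]) ?X (?bs @ [y])" for x y
    proof -
      have nth: "(?bs @ [z]) ! 3 = z" "(?bs @ [z]) ! i = b" for z
        using \<open>i < 3\<close> \<open>?bs ! i = b\<close> by (simp, subst nth_append) simp
      show ?thesis
        using wl_indist_atomic(1)[OF xy, of 3 i] \<open>i < 3\<close> unfolding nth by simp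
    qed
    then show ?thesis by (simp add: invariant_pair_def)
  qed
  have nn: "Suc 0 < n * n" "n < n * n" using n cell_less[of 0 n 1] cell_less[of 1 n 0] by auto
  have "wl_identified (Suc (length ?bs)) ?X"
  proof (intro wl_identified_if_discrete X)
    fix x y assume "x \<in> pverts ?X" "y \<in> pverts ?X" "wl_indist ?X (?bs @ [x]) ?X (?bs @ [y])"
    then have "?R x y" by blast
    then show "x = y"
      using equitable_rel_cyclic_start(1)[OF L(1,1) n L(2,2) R] base by simp
  qed (use n in \<open>auto simp: pverts_latin_graph[OF L(1) n] intro: nn\<close>)
  then show ?thesis by (simp add: eval_nat_numeral)
qed

text \<open>The graph of \<open>h\<close> is equitable and, \<open>h\<close> being injective, the
  three fixed cells are invariant; the recognition of lines then applies to every cell.\<close>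

lemma latin_graph_iso_fixing_base:
  assumes L: "latin_square n L" "latin_square n L'" and n: "5 \<le> n"
    and start: "cyclic_start n L" "cyclic_start n L'"
    and h: "bij_betw h (pverts (latin_graph n L)) (pverts (latin_graph n L'))"
      "\<And>a b. a \<in> pverts (latin_graph n L) \<Longrightarrow> b \<in> pverts (latin_graph n L) \<Longrightarrow>
        (a, b) \<in> parcs (latin_graph n L) \<longleftrightarrow> (h a, h b) \<in> parcs (latin_graph n L')"
    and fixed: "h 0 = 0" "h 1 = 1" "h n = n" and ij: "i < n" "j < n"
  shows "L i j = L' i j"
proof -
  let ?R = "\<lambda>x y. x \<in> pverts (latin_graph n L) \<and> y = h x"
  have V: "pverts (latin_graph n L) = {..<n * n}" by (rule pverts_latin_graph) fact+
  have nn: "0 < n * n" "1 < n * n" "n < n * n" using n cell_less[of 0 n 1] cell_less[of 1 n 0] by auto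
  have base: "invariant_pair ?R {b} {b}" if "b < n * n" "h b = b" for b
    using that h(1) by (auto simp: invariant_pair_def V bij_betw_def inj_on_def)
  have "?R (i * n + j) (h (i * n + j))" using ij by (simp add: V cell_less)
  from equitable_rel_cyclic_start(2)[OF L n start equitable_rel_iso[OF h] base base base this] nn fixed ij
  show ?thesis by simp
qed

section \<open>Many Latin squares by switching intercalates\<close>

text \<open>
  The Cayley table of \<open>\<int>/2m\<close> splits into intercalates with rows \<open>x, x + m\<close> and columns
  \<open>y, y + m\<close>; switching any set of them keeps the square Latin.
\<close>

definition switched_square :: "nat \<Rightarrow> (nat \<times> nat) set \<Rightarrow> nat \<Rightarrow> nat \<Rightarrow> nat" where
  "switched_square m t x y = (x + y + (if (x mod m, y mod m) \<in> t then m else 0)) mod (2 * m)"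

lemma add_mod_cancel_left: "(c + a) mod k = (c + b) mod k \<longleftrightarrow> a mod k = b mod k" for a b c k :: nat
proof (induction a b rule: linorder_wlog)
  case (le a b)
  then show ?case
    using mod_eq_dvd_iff_nat[of "c + a" "c + b" k] mod_eq_dvd_iff_nat[of a b k] by auto
qed auto

lemma switched_square_mod: "switched_square m t x y mod m = (x + y) mod m"
  by (simp add: switched_square_def mod_mod_cancel)

text \<open>Equal symbols in one row force equal columns modulo \<open>m\<close>. Both cells then
  belong to the same intercalate and receive the same shift \<open>e\<close>, which cancels.\<close>

lemma bij_betw_switched_square_row:
  assumes "0 < m"
  shows "bij_betw (switched_square m t x) {..<2 * m} {..<2 * m}"
proof -
  have "inj_on (switched_square m t x) {..<2 * m}"
  proof (rule inj_onI)
    fix y y' assume y: "y \<in> {..<2 * m}" "y' \<in> {..<2 * m}"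
      and eq: "switched_square m t x y = switched_square m t x y'"
    then have "y mod m = y' mod m"
      using switched_square_mod[of m t x] add_mod_cancel_left by metis
    define e where "e = (if (x mod m, y mod m) \<in> t then m else 0)"
    have "((x + e) + y) mod (2 * m) = ((x + e) + y') mod (2 * m)"
      using eq \<open>y mod m = y' mod m\<close> by (simp add: switched_square_def e_def add_ac)
    then show "y = y'" using y by (simp only: add_mod_cancel_left) simp
  qed
  moreover have "switched_square m t x ` {..<2 * m} \<subseteq> {..<2 * m}"
    using assms by (auto simp: switched_square_def)
  ultimately show ?thesis
    by (simp add: bij_betw_def endo_inj_surj)
qed

lemma switched_square_swap: "switched_square m t x y = switched_square m (t\<inverse>) y x"
  by (simp add: switched_square_def add_ac)

lemma latin_square_switched_square:
  assumes "0 < m"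
  shows "latin_square (2 * m) (switched_square m t)"
  unfolding latin_square_def
  using bij_betw_switched_square_row[OF assms]
  by (auto simp: switched_square_swap[of m t _ j for j])

text \<open>Row residues 0 and 1 and column residue 0 are kept out of \<open>t\<close>, so the first
  two rows and the first column stay those of the Cayley table.\<close>

lemma cyclic_start_switched_square:
  assumes "2 \<le> m" "t \<subseteq> {2..<m} \<times> {1..<m}"
  shows "cyclic_start (2 * m) (switched_square m t)"
proof -
  have "(0, y) \<notin> t" "(Suc 0, y) \<notin> t" "(y, 0) \<notin> t" for y using assms(2) by auto
  then show ?thesis using assms(1) by (auto simp: cyclic_start_def switched_square_def)
qed

text \<open>Cell (i, j) with both indices below \<open>m\<close> represents its intercalate, and a
  switch changes its symbol because \<open>m\<close> is not 0 modulo \<open>2 * m\<close>.\<close>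

lemma switched_square_inject:
  assumes "t \<subseteq> {..<m} \<times> {..<m}" "t' \<subseteq> {..<m} \<times> {..<m}"
    and eq: "\<And>i j. i < m \<Longrightarrow> j < m \<Longrightarrow> switched_square m t i j = switched_square m t' i j"
  shows "t = t'"
proof -
  have "(i, j) \<in> t \<longleftrightarrow> (i, j) \<in> t'" if "i < m" "j < m" for i j
    using eq[OF that] that add_mod_cancel_left[of "i + j" m "2 * m" 0]
      add_mod_cancel_left[of "i + j" 0 "2 * m" m]
    by (auto simp: switched_square_def split: if_splits)
  then show ?thesis using assms(1,2) by blast
qed

section \<open>Counting isomorphism classes\<close>

text \<open>In a maximal unrelated subset \<open>B\<close>, every element of \<open>A\<close> is
  related to a member of \<open>B\<close>, since otherwise it could be added. Hence the sets
  \<open>{a\<in>A. r a b}\<close> with \<open>b\<close> in \<open>B\<close> cover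
  \<open>A\<close>.\<close>

lemma pairwise_unrelated_subset:
  assumes "finite A" and refl: "\<And>a. a \<in> A \<Longrightarrow> r a a"
    and sym: "\<And>a b. a \<in> A \<Longrightarrow> b \<in> A \<Longrightarrow> r a b \<Longrightarrow> r b a"
    and bound: "\<And>b. b \<in> A \<Longrightarrow> card {a\<in>A. r a b} \<le> k"
  shows "\<exists>B\<subseteq>A. pairwise (\<lambda>a b. \<not> r a b) B \<and> card A \<le> k * card B"
proof -
  let ?S = "{B. B \<subseteq> A \<and> pairwise (\<lambda>a b. \<not> r a b) B}"
  have "finite ?S" using assms(1) by simp
  moreover have "{} \<in> ?S" by simp
  then have "?S \<noteq> {}" by blast
  ultimately have "\<exists>B\<in>?S. \<forall>C\<in>?S. B \<subseteq> C \<longrightarrow> B = C"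
    by (rule finite_has_maximal)
  then obtain B where B: "B \<in> ?S" and max: "\<forall>C\<in>?S. B \<subseteq> C \<longrightarrow> B = C" by (elim bexE)
  have "\<exists>b\<in>B. r a b" if a: "a \<in> A" for a
  proof (rule ccontr)
    assume no: "\<not> ?thesis"
    then have "insert a B \<in> ?S"
    proof -
      have "B \<subseteq> A" "pairwise (\<lambda>a b. \<not> r a b) B" using B by simp_all
      moreover have "\<not> r a b" if "b \<in> B" for b using no that by simp
      moreover have "\<not> r b a" if "b \<in> B" for b
        using calculation(1,3) sym[of b a] a that by auto
      ultimately show ?thesis using a by (simp add: pairwise_insert)
    qed
    then have "B = insert a B" using max by blast
    then show False using no refl[OF a] by blast
  qed
  then have "A = (\<Union>b\<in>B. {a\<in>A. r a b})" by blast
  moreover have "finite B" using B assms(1) finite_subset by auto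
  ultimately have "card A \<le> (\<Sum>b\<in>B. card {a\<in>A. r a b})"
    using card_UN_le[of B "\<lambda>b. {a\<in>A. r a b}"] by simp
  also have "\<dots> \<le> (\<Sum>b\<in>B. k)" using B by (intro sum_mono bound) auto
  finally show ?thesis using B by (intro exI[of _ B]) (simp add: mult.commute)
qed

lemma graph_iso_sym:
  assumes "pair_graph X" "pair_graph Y" "graph_iso X Y"
  shows "graph_iso Y X"
proof -
  obtain f where f: "bij_betw f (pverts X) (pverts Y)"
    "\<forall>a\<in>pverts X. \<forall>b\<in>pverts X. (a, b) \<in> parcs X \<longleftrightarrow> (f a, f b) \<in> parcs Y"
    using graph_iso_iff[OF assms(1,2)] assms(3) by blast
  let ?g = "inv_into (pverts X) f"
  have g: "bij_betw ?g (pverts Y) (pverts X)" using f(1) by (rule bij_betw_inv_into)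
  have "?g y \<in> pverts X" "f (?g y) = y" if "y \<in> pverts Y" for y
    using that f(1) bij_betwE[OF g] by (auto simp: bij_betw_inv_into_right)
  then show ?thesis
    unfolding graph_iso_iff[OF assms(2,1)] using f(2) g by (intro exI[of _ ?g]) auto
qed

lemma graph_iso_refl:
  assumes "pair_graph X"
  shows "graph_iso X X"
  unfolding graph_iso_iff[OF assms assms] by (intro exI[of _ id]) auto

text \<open>Choose an isomorphism \<open>f t\<close> onto \<open>X\<close> for each \<open>t\<close>
  and record the images of the three base cells. If \<open>s\<close> and \<open>t\<close> have the
  same record, the inverse of \<open>f t\<close> after \<open>f s\<close> fixes the base cells, so
  the squares agree.\<close>

lemma card_switched_square_iso_class:
  assumes m: "3 \<le> m" and X: "pair_graph X" "pverts X = {..<(2 * m) * (2 * m)}"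
  shows "card {t \<in> Pow ({2..<m} \<times> {1..<m}). graph_iso (latin_graph (2 * m) (switched_square m t)) X}
    \<le> ((2 * m) * (2 * m)) ^ 3"
proof -
  let ?n = "2 * m"
  let ?N = "?n * ?n"
  let ?G = "\<lambda>t. latin_graph ?n (switched_square m t)"
  let ?C = "{t \<in> Pow ({2..<m} \<times> {1..<m}). graph_iso (?G t) X}"
  have n: "5 \<le> ?n" using m by simp
  have latin: "latin_square ?n (switched_square m t)" for t
    using latin_square_switched_square m by simp
  have start: "cyclic_start ?n (switched_square m t)" if "t \<in> ?C" for t
    using cyclic_start_switched_square that m by simp
  have V: "pverts (?G t) = {..<?N}" for t using pverts_latin_graph[OF latin n] .
  have "\<forall>t\<in>?C. \<exists>f. bij_betw f {..<?N} {..<?N} \<and>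
      (\<forall>a\<in>{..<?N}. \<forall>b\<in>{..<?N}. (a, b) \<in> parcs (?G t) \<longleftrightarrow> (f a, f b) \<in> parcs X)"
    using graph_iso_iff[OF pair_graph_latin_graph[OF latin n] X(1)] by (auto simp: V X(2))
  from bchoice[OF this] obtain f where "\<forall>t\<in>?C. bij_betw (f t) {..<?N} {..<?N} \<and>
      (\<forall>a\<in>{..<?N}. \<forall>b\<in>{..<?N}. (a, b) \<in> parcs (?G t) \<longleftrightarrow> (f t a, f t b) \<in> parcs X)" ..
  then have f: "\<And>t. t \<in> ?C \<Longrightarrow> bij_betw (f t) {..<?N} {..<?N}"
    "\<And>t a b. t \<in> ?C \<Longrightarrow> a < ?N \<Longrightarrow> b < ?N \<Longrightarrow> (a, b) \<in> parcs (?G t) \<longleftrightarrow> (f t a, f t b) \<in> parcs X"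
    by simp_all
  have nn: "0 < ?N" "1 < ?N" "?n < ?N" using n cell_less[of 0 ?n 1] cell_less[of 1 ?n 0] by auto
  let ?base = "\<lambda>t. (f t 0, f t 1, f t ?n)"
  have "inj_on ?base ?C"
  proof (rule inj_onI)
    fix s t assume s: "s \<in> ?C" and t: "t \<in> ?C" and eq: "?base s = ?base t"
    let ?g = "inv_into {..<?N} (f t)"
    have g: "bij_betw ?g {..<?N} {..<?N}" using f(1)[OF t] by (rule bij_betw_inv_into)
    have fg: "f t (?g y) = y" "?g y < ?N" if "y < ?N" for y
      using that f(1)[OF t] bij_betwE[OF g] by (auto simp: bij_betw_inv_into_right)
    have gf: "?g (f t y) = y" if "y < ?N" for y
      using that f(1)[OF t] by (simp add: bij_betw_inv_into_left)
    have fs: "f s a < ?N" if "a < ?N" for a using bij_betwE[OF f(1)[OF s]] that by blast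
    have "switched_square m s i j = switched_square m t i j" if "i < m" "j < m" for i j
    proof (rule latin_graph_iso_fixing_base[OF latin latin n start[OF s] start[OF t]])
      show "bij_betw (?g \<circ> f s) (pverts (?G s)) (pverts (?G t))"
        unfolding V using f(1)[OF s] g by (rule bij_betw_trans)
      fix a b assume "a \<in> pverts (?G s)" "b \<in> pverts (?G s)"
      then show "(a, b) \<in> parcs (?G s) \<longleftrightarrow> ((?g \<circ> f s) a, (?g \<circ> f s) b) \<in> parcs (?G t)"
        unfolding V using f(2)[OF s] f(2)[OF t] fg fs by simp
    qed (use eq gf[OF nn(1)] gf[OF nn(2)] gf[OF nn(3)] that in auto)
    moreover have "s \<subseteq> {..<m} \<times> {..<m}" "t \<subseteq> {..<m} \<times> {..<m}" using s t by auto
    ultimately show "s = t" by (intro switched_square_inject) auto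
  qed
  moreover have "?base ` ?C \<subseteq> {..<?N} \<times> {..<?N} \<times> {..<?N}"
  proof (intro image_subsetI)
    fix t assume "t \<in> ?C"
    then have "f t a < ?N" if "a < ?N" for a using bij_betwE[OF f(1)] that by simp
    from this[OF nn(1)] this[OF nn(2)] this[OF nn(3)]
    show "?base t \<in> {..<?N} \<times> {..<?N} \<times> {..<?N}" by simp
  qed
  ultimately have "card ?C \<le> card ({..<?N} \<times> {..<?N} \<times> {..<?N})"
    by (intro card_inj_on_le) auto
  also have "\<dots> = ?N ^ 3" by (simp only: card_cartesian_product card_lessThan power3_eq_cube mult.assoc)
  finally show ?thesis .
qed

lemma ex_family_latin_graphs:
  assumes "3 \<le> m"
  shows "\<exists>F :: nat pair_pre_digraph set.
    pairwise (\<lambda>X Y. \<not> graph_iso X Y) F \<and> finite F \<and>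
    (\<forall>X\<in>F. strongly_regular X ((2 * m)\<^sup>2) (3 * (2 * m - 1)) (2 * m) 6 \<and> wl_identified 4 X) \<and>
    2 ^ ((m - 2) * (m - 1)) \<le> ((2 * m) * (2 * m)) ^ 3 * card F"
proof -
  let ?G = "\<lambda>t. latin_graph (2 * m) (switched_square m t)"
  let ?T = "Pow ({2..<m} \<times> {1..<m})"
  have n: "5 \<le> 2 * m" using assms by simp
  have latin: "latin_square (2 * m) (switched_square m t)" for t
    using latin_square_switched_square assms by simp
  note graph = pair_graph_latin_graph[OF latin n]
  have "\<exists>B\<subseteq>?T. pairwise (\<lambda>s t. \<not> graph_iso (?G s) (?G t)) B \<and>
      card ?T \<le> ((2 * m) * (2 * m)) ^ 3 * card B"
  proof (rule pairwise_unrelated_subset)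
    show "graph_iso (?G t) (?G t)" for t using graph_iso_refl[OF graph] .
    show "graph_iso (?G t) (?G s)" if "graph_iso (?G s) (?G t)" for s t
      using graph_iso_sym[OF graph graph that] .
    show "card {s \<in> ?T. graph_iso (?G s) (?G t)} \<le> ((2 * m) * (2 * m)) ^ 3" for t
      using card_switched_square_iso_class[OF assms graph pverts_latin_graph[OF latin n]] .
  qed simp
  then obtain B where B: "B \<subseteq> ?T" "pairwise (\<lambda>s t. \<not> graph_iso (?G s) (?G t)) B"
    "card ?T \<le> ((2 * m) * (2 * m)) ^ 3 * card B" by blast
  \<comment> \<open>Equal graphs are isomorphic, so distinct indices in \<open>B\<close> give
    distinct graphs.\<close>
  have "inj_on ?G B"
    using B(2) graph_iso_refl[OF graph] unfolding inj_on_def pairwise_def by metis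
  then have "card (?G ` B) = card B" by (rule card_image)
  moreover have "card ?T = 2 ^ ((m - 2) * (m - 1))"
    by (simp add: card_Pow card_cartesian_product)
  moreover have "pairwise (\<lambda>X Y. \<not> graph_iso X Y) (?G ` B)"
    unfolding pairwise_image by (rule pairwise_mono[OF B(2)]) simp_all
  moreover have "finite (?G ` B)" using B(1) by (intro finite_imageI) (auto intro: finite_subset)
  moreover have "strongly_regular (?G t) ((2 * m)\<^sup>2) (3 * (2 * m - 1)) (2 * m) 6 \<and> wl_identified 4 (?G t)"
    if "t \<in> B" for t
    using strongly_regular_latin_graph[OF latin n] wl_identified_latin_graph[OF latin _ n]
      cyclic_start_switched_square[of m t] assms that B(1) by auto
  ultimately show ?thesis using B(3) by (intro exI[of _ "?G ` B"]) auto
qed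

section \<open>Size estimate and conclusion\<close>

lemma family_size_estimate:
  assumes q: "5 \<le> q"
  shows "((2 * q\<^sup>2) * (2 * q\<^sup>2)) ^ 3 * q ^ q\<^sup>2 < (2::nat) ^ ((q\<^sup>2 - 2) * (q\<^sup>2 - 1))"
proof -
  \<comment> \<open>Replacing each factor q by 2^q turns the claim into a comparison of
    exponents.\<close>
  have q2: "q \<le> 2 ^ q" using less_exp[of q] by simp
  have "(2 * q\<^sup>2) * (2 * q\<^sup>2) = 2\<^sup>2 * q ^ 4" by (simp add: power2_eq_square power4_eq_xxxx)
  also have "\<dots> \<le> 2\<^sup>2 * (2 ^ q) ^ 4" by (intro mult_left_mono power_mono q2) auto
  also have "\<dots> = 2 ^ (2 + 4 * q)" by (simp add: power_add power_mult[symmetric] mult.commute)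
  finally have "((2 * q\<^sup>2) * (2 * q\<^sup>2)) ^ 3 * q ^ q\<^sup>2 \<le> (2 ^ (2 + 4 * q)) ^ 3 * (2 ^ q) ^ q\<^sup>2"
    by (intro mult_mono power_mono q2) auto
  also have "\<dots> = 2 ^ (3 * (2 + 4 * q) + q * q\<^sup>2)"
    by (simp only: power_mult[symmetric] power_add[symmetric] mult.commute[of "2 + 4 * q" 3])
  also have "\<dots> < 2 ^ ((q\<^sup>2 - 2) * (q\<^sup>2 - 1))"
  proof (rule power_strict_increasing)
    \<comment> \<open>This removes the truncated subtractions and leaves polynomials in
      \<open>k\<close> that compare coefficient by coefficient.\<close>
    obtain k where k: "q = 5 + k" using q le_Suc_ex by blast
    have "q\<^sup>2 - 2 = 23 + 10 * k + k\<^sup>2" "q\<^sup>2 - 1 = 24 + 10 * k + k\<^sup>2"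
      by (simp_all add: k power2_eq_square algebra_simps)
    then show "3 * (2 + 4 * q) + q * q\<^sup>2 < (q\<^sup>2 - 2) * (q\<^sup>2 - 1)"
      by (simp add: k power2_eq_square algebra_simps)
  qed simp
  finally show ?thesis .
qed

theorem theorem1p1:
  shows "\<exists>c > (0 :: real). \<exists>q\<^sub>0 :: nat. \<forall>q \<ge> q\<^sub>0. (\<exists>e :: nat. q = 2 ^ e) \<longrightarrow>
    (\<exists>F :: nat pair_pre_digraph set.
      pairwise (\<lambda>X Y. \<not> graph_iso X Y) F \<and>
      (\<exists>n k l \<mu>. \<forall>X\<in>F. strongly_regular X n k l \<mu>) \<and>
      finite F \<and>
      wl_dim_family F \<le> 4 \<and>
      real (card F) > real q powr (c * (real q)\<^sup>2))"
proof (intro exI[of _ "1::real"] exI[of _ "5::nat"] conjI allI impI)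
  \<comment> \<open>More than q^(q^2) graphs are obtained, whence c = 1; the threshold 5 comes from
    \<open>family_size_estimate\<close>.\<close>
  fix q :: nat assume q: "5 \<le> q"
  let ?m = "q\<^sup>2"
  have "3 \<le> ?m" using q power_mono[of 5 q 2] by simp
  then obtain F :: "nat pair_pre_digraph set" where F: "pairwise (\<lambda>X Y. \<not> graph_iso X Y) F" "finite F"
    "\<And>X. X \<in> F \<Longrightarrow> strongly_regular X ((2 * ?m)\<^sup>2) (3 * (2 * ?m - 1)) (2 * ?m) 6"
    "\<And>X. X \<in> F \<Longrightarrow> wl_identified 4 X"
    "2 ^ ((?m - 2) * (?m - 1)) \<le> ((2 * ?m) * (2 * ?m)) ^ 3 * card F"
    using ex_family_latin_graphs[of ?m] by blast
  have "((2 * ?m) * (2 * ?m)) ^ 3 * q ^ ?m < ((2 * ?m) * (2 * ?m)) ^ 3 * card F"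
    using family_size_estimate[OF q] F(5) by (rule less_le_trans)
  then have card: "q ^ ?m < card F" by (metis nat_mult_less_cancel_disj)
  \<comment> \<open>The \<open>Max\<close> in \<open>wl_dim_family\<close> is thus taken over a
    nonempty set.\<close>
  then have "F \<noteq> {}" by auto
  moreover have "wl_dim X \<le> 4" if "X \<in> F" for X
    unfolding wl_dim_def using F(4)[OF that] by (intro Least_le) simp
  ultimately have dim: "wl_dim_family F \<le> 4"
    using F(2) by (simp add: wl_dim_family_def)
  have srg: "\<exists>n k l \<mu>. \<forall>X\<in>F. strongly_regular X n k l \<mu>"
    using F(3) by blast
  have "real q powr (1 * (real q)\<^sup>2) = real (q ^ ?m)"
    using q powr_realpow[of "real q" ?m] by simp
  then show "\<exists>F :: nat pair_pre_digraph set.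
      pairwise (\<lambda>X Y. \<not> graph_iso X Y) F \<and>
      (\<exists>n k l \<mu>. \<forall>X\<in>F. strongly_regular X n k l \<mu>) \<and>
      finite F \<and>
      wl_dim_family F \<le> 4 \<and>
      real (card F) > real q powr (1 * (real q)\<^sup>2)"
    using F(1,2) card srg dim by (intro exI[of _ F] conjI) simp_all
qed simp

end
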